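(* Let $k$ be a field and $H$ a finite dimensional Hopf algebra over $k$ with antipode $S$. Let $Y=H^*\#(H\otimes H^{op})\# H^{*op}$ be the two-sided crossed product and $Z=(H^*\otimes H^{*op})\bowtie(H\otimes H^{op})$ the diagonal crossed product. Then $Y$ and $Z$ are isomorphic as algebras via the mutually inverse maps $\alpha:Y\to Z$, $\alpha^{-1}:Z\to Y$, $$\alpha(p\#(h\otimes g)\# q)=\sum (p\otimes(h_2\rightharpoonup q\leftharpoonup g_2))\bowtie(h_1\otimes g_1),$$ $$\alpha^{-1}((p\otimes q)\bowtie(h\otimes g))=\sum p\#(h_1\otimes g_1)\# S(h_2)\rightharpoonup q\leftharpoonup S^{-1}(g_2).$$
   Context: Everything is over a fixed field $k$, $\otimes=\otimes_k$, and Sweedler notation is used. The antipode $S$ is bijective since $H$ is finite dimensional; $H^*$ is the dual Hopf algebra, with $(pq)(h)=\sum p(h_1)q(h_2)$. $H^{op}$, $H^{*op}$ denote opposite algebras. Regular actions of $H$ on $H^*$: $(h\rightharpoonup f)(h')=f(h'h)$ and $(f\leftharpoonup h')(h)=f(h'h)$. The algebra $Y$ has underlying space $H^*\otimes(H\otimes H)\otimes H^*$, elements written $p\#(h\otimes g)\# q$, unit $1\#(1\otimes1)\#1$, and multiplication $$(p\# (h\otimes g)\# q)(p'\# (h'\otimes g')\# q')=\sum p(h_1\rightharpoonup p'\leftharpoonup g_1)\# (h_2h'_1\otimes g'_1g_2)\# q'(S(h'_2)\rightharpoonup q\leftharpoonup S^{-1}(g'_2)).$$ The algebra $Z$ has underlying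 space $(H^*\otimes H^* )\otimes(H\otimes H)$, elements written $(p\otimes q)\bowtie(h\otimes g)$, unit $(1\otimes1)\bowtie(1\otimes1)$, and multiplication $$((p\otimes q)\bowtie(h\otimes g))((p'\otimes q')\bowtie(h'\otimes g'))=\sum (p(h_1\rightharpoonup p'\leftharpoonup g_1)\otimes(h_3\rightharpoonup q'\leftharpoonup g_3)q)\bowtie(h_2h'\otimes g'g_2).$$ In both formulas all products on the right-hand side are taken in $H$ and $H^*$ (not in the opposite algebras). *)

theory Defs
  imports Complex_Main "HOL-Library.Function_Algebras"
begin

section \<open>Vector spaces on a carrier, linear and bilinear maps\<close>

text \<open>The carrier is a subspace of the ambient type, because dual spaces and tensor
  products are subspaces of function types.\<close>

record ('k, 'v) vspace =
  carr :: "'v set"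
  scal :: "'k \<Rightarrow> 'v \<Rightarrow> 'v"

definition k_vspace :: "('k::field, 'v::ab_group_add, 'z) vspace_scheme \<Rightarrow> bool" where
  "k_vspace V \<longleftrightarrow> vector_space (scal V) \<and> module.subspace (scal V) (carr V)"

definition linear_map ::
  "('k::field, 'v::ab_group_add, 'y) vspace_scheme \<Rightarrow>
   ('k, 'w::ab_group_add, 'z) vspace_scheme \<Rightarrow> ('v \<Rightarrow> 'w) \<Rightarrow> bool" where
  "linear_map V W f \<longleftrightarrow>
     (\<forall>x\<in>carr V. f x \<in> carr W) \<and>
     (\<forall>x\<in>carr V. \<forall>y\<in>carr V. f (x + y) = f x + f y) \<and>
     (\<forall>c. \<forall>x\<in>carr V. f (scal V c x) = scal W c (f x))"

definition bilinear_map ::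
  "('k::field, 'v::ab_group_add, 'x) vspace_scheme \<Rightarrow>
   ('k, 'w::ab_group_add, 'y) vspace_scheme \<Rightarrow>
   ('k, 'u::ab_group_add, 'z) vspace_scheme \<Rightarrow> ('v \<Rightarrow> 'w \<Rightarrow> 'u) \<Rightarrow> bool" where
  "bilinear_map V W U b \<longleftrightarrow>
     (\<forall>v\<in>carr V. linear_map W U (b v)) \<and> (\<forall>w\<in>carr W. linear_map V U (\<lambda>v. b v w))"

definition ground :: "('k::field, 'k) vspace" where
  "ground = \<lparr>carr = UNIV, scal = (*)\<rparr>"

definition fscale :: "'k::field \<Rightarrow> ('x \<Rightarrow> 'k) \<Rightarrow> 'x \<Rightarrow> 'k" where
  "fscale c f = (\<lambda>x. c * f x)"

section \<open>Tensor products over the ground field\<close>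

text \<open>The tensor product is the free vector space on pairs modulo the bilinearity relations.
  Over a field, two formal sums of pairs are congruent iff all bilinear forms take the same
  value on them, so a class is represented by the functional it induces on bilinear forms.
  Forms that are not bilinear on the carriers are sent to \<open>0\<close>. The universal property is
  proved below (\<open>tensor_lift_pure\<close>, \<open>linear_map_tensor_lift\<close>, \<open>tensor_linear_eqI\<close>).\<close>

type_synonym ('k, 'v, 'w) tensor = "('v \<Rightarrow> 'w \<Rightarrow> 'k) \<Rightarrow> 'k"

definition pure_tensor ::
  "('k::field, 'v::ab_group_add, 'x) vspace_scheme \<Rightarrow>
   ('k, 'w::ab_group_add, 'y) vspace_scheme \<Rightarrow> 'v \<Rightarrow> 'w \<Rightarrow> ('k, 'v, 'w) tensor" where
  "pure_tensor V W v w = (\<lambda>b. if bilinear_map V W ground b then b v w else 0)"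

definition tensor ::
  "('k::field, 'v::ab_group_add, 'x) vspace_scheme \<Rightarrow>
   ('k, 'w::ab_group_add, 'y) vspace_scheme \<Rightarrow> ('k, ('k, 'v, 'w) tensor) vspace" where
  "tensor V W =
     \<lparr>carr = module.span fscale {pure_tensor V W v w | v w. v \<in> carr V \<and> w \<in> carr W},
      scal = fscale\<rparr>"

text \<open>Sweedler-style summation: write \<open>t\<close> as a finite sum of pure tensors \<open>v \<otimes> w\<close> and sum up
  \<open>F v w\<close>. For bilinear \<open>F\<close> the result does not depend on the chosen presentation.\<close>

definition presentation ::
  "('k::field, 'v::ab_group_add, 'x) vspace_scheme \<Rightarrow>
   ('k, 'w::ab_group_add, 'y) vspace_scheme \<Rightarrow> ('k, 'v, 'w) tensor \<Rightarrow> ('v \<times> 'w) list" where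
  "presentation V W t =
     (SOME xs. set xs \<subseteq> carr V \<times> carr W \<and> t = (\<Sum>(v, w)\<leftarrow>xs. pure_tensor V W v w))"

definition tensor_lift ::
  "('k::field, 'v::ab_group_add, 'x) vspace_scheme \<Rightarrow>
   ('k, 'w::ab_group_add, 'y) vspace_scheme \<Rightarrow>
   ('v \<Rightarrow> 'w \<Rightarrow> 'u::ab_group_add) \<Rightarrow> ('k, 'v, 'w) tensor \<Rightarrow> 'u" where
  "tensor_lift V W F t = (\<Sum>(v, w)\<leftarrow>presentation V W t. F v w)"

lemma bilinear_mapD:
  assumes "bilinear_map V W U b" and "v \<in> carr V" "w \<in> carr W"
  shows "b v w \<in> carr U"
    and "v' \<in> carr V \<Longrightarrow> b (v + v') w = b v w + b v' w"
    and "w' \<in> carr W \<Longrightarrow> b v (w + w') = b v w + b v w'"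
    and "b (scal V c v) w = scal U c (b v w)"
    and "b v (scal W c w) = scal U c (b v w)"
  using assms by (auto simp: bilinear_map_def linear_map_def)

lemma vector_space_fscale: "vector_space (fscale :: 'k::field \<Rightarrow> ('x \<Rightarrow> 'k) \<Rightarrow> 'x \<Rightarrow> 'k)"
  by unfold_locales (auto simp: fscale_def fun_eq_iff algebra_simps)

lemma vector_space_ground: "vector_space ((*) :: 'k::field \<Rightarrow> 'k \<Rightarrow> 'k)"
  by unfold_locales (auto simp: algebra_simps)

lemma k_vspace_ground: "k_vspace ground"
proof -
  interpret vector_space "(*) :: 'a \<Rightarrow> 'a \<Rightarrow> 'a" by (rule vector_space_ground)
  show ?thesis using vector_space_ground by (simp add: k_vspace_def ground_def)
qed

lemma k_vspaceD:
  assumes "k_vspace V"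
  shows "vector_space (scal V)" and "0 \<in> carr V"
    and "x \<in> carr V \<Longrightarrow> y \<in> carr V \<Longrightarrow> x + y \<in> carr V"
    and "x \<in> carr V \<Longrightarrow> scal V c x \<in> carr V"
proof -
  interpret vector_space "scal V" using assms by (simp add: k_vspace_def)
  show "vector_space (scal V)" by (rule vector_space_axioms)
  have "subspace (carr V)" using assms by (simp add: k_vspace_def)
  then show "0 \<in> carr V" "x \<in> carr V \<Longrightarrow> y \<in> carr V \<Longrightarrow> x + y \<in> carr V"
    "x \<in> carr V \<Longrightarrow> scal V c x \<in> carr V"
    by (auto simp: subspace_def)
qed

lemma k_vspace_tensor: "k_vspace (tensor V W)"
proof -
  interpret vector_space fscale by (rule vector_space_fscale)
  show ?thesis
    using vector_space_fscale by (auto simp: k_vspace_def tensor_def)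
qed

lemma pure_tensor_mem: "v \<in> carr V \<Longrightarrow> w \<in> carr W \<Longrightarrow> pure_tensor V W v w \<in> carr (tensor V W)"
proof -
  interpret vector_space fscale by (rule vector_space_fscale)
  show "v \<in> carr V \<Longrightarrow> w \<in> carr W \<Longrightarrow> pure_tensor V W v w \<in> carr (tensor V W)"
    unfolding tensor_def vspace.simps by (rule span_base) blast
qed

lemma bilinear_map_pure_tensor: "bilinear_map V W (tensor V W) (pure_tensor V W)"
  unfolding bilinear_map_def linear_map_def
  by (auto simp: pure_tensor_mem)
     (auto simp: tensor_def pure_tensor_def fscale_def fun_eq_iff bilinear_mapD ground_def
       dest: bilinear_mapD(2-5)[where U = ground])

lemma sum_list_apply: "(\<Sum>x\<leftarrow>xs. f x) b = (\<Sum>x\<leftarrow>xs. f x b)"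
  by (induction xs) auto

lemma tensor_presentation_exists:
  assumes V: "k_vspace V" and t: "t \<in> carr (tensor V W)"
  shows "\<exists>xs. set xs \<subseteq> carr V \<times> carr W \<and> t = (\<Sum>(v, w)\<leftarrow>xs. pure_tensor V W v w)"
proof -
  interpret vector_space "fscale :: 'a \<Rightarrow> (('b \<Rightarrow> 'd \<Rightarrow> 'a) \<Rightarrow> 'a) \<Rightarrow> _" by (rule vector_space_fscale)
  let ?P = "\<lambda>xs. (\<Sum>(v, w)\<leftarrow>xs. pure_tensor V W v w)"
  from t have "t \<in> span {pure_tensor V W v w | v w. v \<in> carr V \<and> w \<in> carr W}"
    by (simp add: tensor_def)
  then show ?thesis
  proof (induction rule: span_induct_alt)
    case base
    show ?case by (rule exI[of _ "[]"]) simp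
  next
    case (step c x y)
    then obtain v w xs where *: "v \<in> carr V" "w \<in> carr W" "x = pure_tensor V W v w"
      "set xs \<subseteq> carr V \<times> carr W" "y = ?P xs" by auto
    have "fscale c x = pure_tensor V W (scal V c v) w"
      using bilinear_mapD(4)[OF bilinear_map_pure_tensor *(1,2)] * by (simp add: tensor_def)
    with * V show ?case
      by (intro exI[of _ "(scal V c v, w) # xs"]) (auto simp: k_vspaceD)
  qed
qed

lemma functional_separates:
  assumes "vector_space s" and "x \<noteq> 0"
  obtains f where "Vector_Spaces.linear s (*) f" and "f x \<noteq> 0"
proof -
  interpret vector_space_pair s "(*)"
    using assms(1) vector_space_ground by (simp add: vector_space_pair_def)
  have "vs1.independent {x}" using assms(2) by simp
  from linear_independent_extend[OF this, of "\<lambda>_. 1"] that show ?thesis by auto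
qed

lemma tensor_lift_eq:
  assumes U: "k_vspace U" and F: "bilinear_map V W U F"
    and xs: "set xs \<subseteq> carr V \<times> carr W"
  shows "tensor_lift V W F (\<Sum>(v, w)\<leftarrow>xs. pure_tensor V W v w) = (\<Sum>(v, w)\<leftarrow>xs. F v w)"
proof -
  let ?P = "\<lambda>xs. (\<Sum>(v, w)\<leftarrow>xs. pure_tensor V W v w)" and ?F = "\<lambda>xs. (\<Sum>(v, w)\<leftarrow>xs. F v w)"
  let ?ys = "presentation V W (?P xs)"
  have "set ?ys \<subseteq> carr V \<times> carr W \<and> ?P xs = ?P ?ys"
    unfolding presentation_def by (rule someI[of _ xs]) (simp add: xs)
  then have ys: "set ?ys \<subseteq> carr V \<times> carr W" and eq: "?P xs = ?P ?ys" by blast+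
  have "?F ?ys = ?F xs"
  proof (rule ccontr)
    assume "?F ?ys \<noteq> ?F xs"
    then have "?F ?ys - ?F xs \<noteq> 0" by simp
    then obtain f where f: "Vector_Spaces.linear (scal U) (*) f" and nz: "f (?F ?ys - ?F xs) \<noteq> 0"
      using functional_separates k_vspaceD(1)[OF U] by blast
    interpret Vector_Spaces.linear "scal U" "(*)" f by (rule f)
    have "bilinear_map V W ground (\<lambda>v w. f (F v w))"
      using F by (auto simp: bilinear_map_def linear_map_def ground_def add scale)
    then have val: "?P zs (\<lambda>v w. f (F v w)) = f (?F zs)" for zs
      by (induction zs) (auto simp: pure_tensor_def add)
    have "f (?F ?ys) = f (?F xs)" using val eq by metis
    with nz show False by (simp add: diff)
  qed
  then show ?thesis by (simp add: tensor_lift_def)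
qed

lemma tensor_lift_pure:
  assumes "k_vspace U" "bilinear_map V W U F" "v \<in> carr V" "w \<in> carr W"
  shows "tensor_lift V W F (pure_tensor V W v w) = F v w"
  using tensor_lift_eq[OF assms(1,2), of "[(v, w)]"] assms(3,4) by simp

lemma linear_map_tensor_lift:
  assumes V: "k_vspace V" and U: "k_vspace U" and F: "bilinear_map V W U F"
  shows "linear_map (tensor V W) U (tensor_lift V W F)"
proof -
  let ?P = "\<lambda>xs. (\<Sum>(v, w)\<leftarrow>xs. pure_tensor V W v w)" and ?F = "\<lambda>xs. (\<Sum>(v, w)\<leftarrow>xs. F v w)"
  interpret vector_space "scal U" using U by (rule k_vspaceD)
  have mem: "?F xs \<in> carr U" if "set xs \<subseteq> carr V \<times> carr W" for xs
    using that by (induction xs) (auto simp: U k_vspaceD bilinear_mapD(1)[OF F])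
  have sc: "set (map (\<lambda>(v, w). (scal V c v, w)) xs) \<subseteq> carr V \<times> carr W \<and>
      ?P (map (\<lambda>(v, w). (scal V c v, w)) xs) = fscale c (?P xs) \<and>
      ?F (map (\<lambda>(v, w). (scal V c v, w)) xs) = scal U c (?F xs)"
    if "set xs \<subseteq> carr V \<times> carr W" for xs c
    using that
  proof (induction xs)
    case Nil
    show ?case by (simp add: fscale_def fun_eq_iff)
  next
    case (Cons a xs)
    obtain v w where a: "a = (v, w)" by fastforce
    with Cons.prems have vw: "v \<in> carr V" "w \<in> carr W" by auto
    have "pure_tensor V W (scal V c v) w = fscale c (pure_tensor V W v w)"
      using bilinear_mapD(4)[OF bilinear_map_pure_tensor vw] by (simp add: tensor_def)
    with Cons a vw V show ?case
      by (auto simp: k_vspaceD bilinear_mapD(4)[OF F] scale_right_distrib)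
         (auto simp: fscale_def fun_eq_iff algebra_simps)
  qed
  show ?thesis
    unfolding linear_map_def
  proof (intro conjI ballI allI)
    fix t assume "t \<in> carr (tensor V W)"
    then obtain xs where xs: "set xs \<subseteq> carr V \<times> carr W" "t = ?P xs"
      using tensor_presentation_exists[OF V] by blast
    then show "tensor_lift V W F t \<in> carr U" by (simp add: tensor_lift_eq[OF U F] mem)
    show "tensor_lift V W F (scal (tensor V W) c t) = scal U c (tensor_lift V W F t)" for c
    proof -
      let ?ys = "map (\<lambda>(v, w). (scal V c v, w)) xs"
      have "scal (tensor V W) c t = ?P ?ys" using sc[OF xs(1)] xs(2) by (simp add: tensor_def)
      then have "tensor_lift V W F (scal (tensor V W) c t) = ?F ?ys"
        using sc[OF xs(1), of c] tensor_lift_eq[OF U F, of ?ys] by simp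
      also have "\<dots> = scal U c (tensor_lift V W F t)"
        using sc[OF xs(1), of c] tensor_lift_eq[OF U F xs(1)] xs(2) by simp
      finally show ?thesis .
    qed
    fix t' assume "t' \<in> carr (tensor V W)"
    then obtain ys where ys: "set ys \<subseteq> carr V \<times> carr W" "t' = ?P ys"
      using tensor_presentation_exists[OF V] by blast
    have "t + t' = ?P (xs @ ys)" using xs ys by simp
    moreover have "tensor_lift V W F (?P (xs @ ys)) = ?F (xs @ ys)"
      using xs ys by (intro tensor_lift_eq[OF U F]) simp
    ultimately show "tensor_lift V W F (t + t') = tensor_lift V W F t + tensor_lift V W F t'"
      using xs ys by (simp add: tensor_lift_eq[OF U F])
  qed
qed

lemma linear_map_sum_list:
  assumes V: "k_vspace V" and W: "k_vspace W" and f: "linear_map V W f" and xs: "set xs \<subseteq> carr V"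
  shows "sum_list xs \<in> carr V \<and> f (sum_list xs) = sum_list (map f xs)"
  using xs
proof (induction xs)
  case Nil
  have "f (0 + 0) = f 0 + f 0"
    using f k_vspaceD(2)[OF V] unfolding linear_map_def by blast
  then show ?case using V by (simp add: k_vspaceD)
next
  case (Cons a xs)
  then show ?case using f V by (auto simp: linear_map_def k_vspaceD)
qed

lemma tensor_linear_eqI:
  assumes V: "k_vspace V" and U: "k_vspace U"
    and f: "linear_map (tensor V W) U f" and g: "linear_map (tensor V W) U g"
    and eq: "\<And>v w. v \<in> carr V \<Longrightarrow> w \<in> carr W \<Longrightarrow> f (pure_tensor V W v w) = g (pure_tensor V W v w)"
    and t: "t \<in> carr (tensor V W)"
  shows "f t = g t"
proof -
  obtain xs where xs: "set xs \<subseteq> carr V \<times> carr W" "t = (\<Sum>(v, w)\<leftarrow>xs. pure_tensor V W v w)"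
    using tensor_presentation_exists[OF V t] by blast
  let ?ys = "map (\<lambda>(v, w). pure_tensor V W v w) xs"
  have "set ?ys \<subseteq> carr (tensor V W)" using xs(1) by (auto simp: pure_tensor_mem)
  then have "f (sum_list ?ys) = sum_list (map f ?ys)" "g (sum_list ?ys) = sum_list (map g ?ys)"
    using linear_map_sum_list[OF k_vspace_tensor U] f g by blast+
  moreover have "map f ?ys = map g ?ys" using xs(1) eq by auto
  ultimately have "f (sum_list ?ys) = g (sum_list ?ys)" by (simp only:)
  then show ?thesis using xs(2) by simp
qed

section \<open>Algebras and Hopf algebras\<close>

record ('k, 'v) alg = "('k, 'v) vspace" +
  amult :: "'v \<Rightarrow> 'v \<Rightarrow> 'v"
  aone :: 'v

definition k_algebra :: "('k::field, 'v::ab_group_add, 'z) alg_scheme \<Rightarrow> bool" where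
  "k_algebra A \<longleftrightarrow>
     k_vspace A \<and> bilinear_map A A A (amult A) \<and> aone A \<in> carr A \<and>
     (\<forall>x\<in>carr A. \<forall>y\<in>carr A. \<forall>z\<in>carr A. amult A (amult A x y) z = amult A x (amult A y z)) \<and>
     (\<forall>x\<in>carr A. amult A (aone A) x = x \<and> amult A x (aone A) = x)"

definition k_algebra_hom ::
  "('k::field, 'v::ab_group_add, 'y) alg_scheme \<Rightarrow>
   ('k, 'w::ab_group_add, 'z) alg_scheme \<Rightarrow> ('v \<Rightarrow> 'w) \<Rightarrow> bool" where
  "k_algebra_hom A B f \<longleftrightarrow>
     linear_map A B f \<and> f (aone A) = aone B \<and>
     (\<forall>x\<in>carr A. \<forall>y\<in>carr A. f (amult A x y) = amult B (f x) (f y))"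

text \<open>A Hopf algebra lives on a whole type of class \<open>ring_1\<close>, which supplies product and unit.\<close>

record ('k, 'h) hopf =
  hscale :: "'k \<Rightarrow> 'h \<Rightarrow> 'h"
  comult :: "'h \<Rightarrow> ('k, 'h, 'h) tensor"
  counit :: "'h \<Rightarrow> 'k"
  antipode :: "'h \<Rightarrow> 'h"

definition hopf_alg :: "('k::field, 'h::ring_1) hopf \<Rightarrow> ('k, 'h) alg" where
  "hopf_alg H = \<lparr>carr = UNIV, scal = hscale H, amult = (*), aone = 1\<rparr>"

definition sweedler2 ::
  "('k::field, 'h::ring_1) hopf \<Rightarrow> 'h \<Rightarrow> ('h \<Rightarrow> 'h \<Rightarrow> 'u::ab_group_add) \<Rightarrow> 'u" where
  "sweedler2 H h F = tensor_lift (hopf_alg H) (hopf_alg H) F (comult H h)"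

definition sweedler3 ::
  "('k::field, 'h::ring_1) hopf \<Rightarrow> 'h \<Rightarrow> ('h \<Rightarrow> 'h \<Rightarrow> 'h \<Rightarrow> 'u::ab_group_add) \<Rightarrow> 'u" where
  "sweedler3 H h F = sweedler2 H h (\<lambda>a h3. sweedler2 H a (\<lambda>h1 h2. F h1 h2 h3))"

definition hopf_algebra :: "('k::field, 'h::ring_1) hopf \<Rightarrow> bool" where
  "hopf_algebra H \<longleftrightarrow>
     (let A = hopf_alg H; AA = tensor A A in
      k_algebra A \<and>
      linear_map A AA (comult H) \<and> linear_map A ground (counit H) \<and> linear_map A A (antipode H) \<and>
      (\<forall>h. sweedler2 H h (\<lambda>a c. sweedler2 H a (\<lambda>x y. pure_tensor A AA x (pure_tensor A A y c))) =
           sweedler2 H h (\<lambda>a c. sweedler2 H c (\<lambda>x y. pure_tensor A AA a (pure_tensor A A x y)))) \<and>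
      (\<forall>h. sweedler2 H h (\<lambda>h1 h2. hscale H (counit H h1) h2) = h) \<and>
      (\<forall>h. sweedler2 H h (\<lambda>h1 h2. hscale H (counit H h2) h1) = h) \<and>
      (\<forall>x y. comult H (x * y) =
         sweedler2 H x (\<lambda>x1 x2. sweedler2 H y (\<lambda>y1 y2. pure_tensor A A (x1 * y1) (x2 * y2)))) \<and>
      comult H 1 = pure_tensor A A 1 1 \<and>
      (\<forall>x y. counit H (x * y) = counit H x * counit H y) \<and> counit H 1 = 1 \<and>
      (\<forall>h. sweedler2 H h (\<lambda>h1 h2. antipode H h1 * h2) = hscale H (counit H h) 1) \<and>
      (\<forall>h. sweedler2 H h (\<lambda>h1 h2. h1 * antipode H h2) = hscale H (counit H h) 1))"

section \<open>The dual algebra and the regular actions\<close>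

definition dual_alg :: "('k::field, 'h::ring_1) hopf \<Rightarrow> ('k, 'h \<Rightarrow> 'k) alg" where
  "dual_alg H =
     \<lparr>carr = {f. linear_map (hopf_alg H) ground f}, scal = fscale,
      amult = (\<lambda>p q h. sweedler2 H h (\<lambda>h1 h2. p h1 * q h2)), aone = counit H\<rparr>"

definition lact :: "'h::ring_1 \<Rightarrow> ('h \<Rightarrow> 'k) \<Rightarrow> 'h \<Rightarrow> 'k" (infixr "\<rightharpoonup>" 75) where
  "h \<rightharpoonup> f = (\<lambda>x. f (x * h))"

definition ract :: "('h::ring_1 \<Rightarrow> 'k) \<Rightarrow> 'h \<Rightarrow> 'h \<Rightarrow> 'k" (infixl "\<leftharpoonup>" 76) where
  "f \<leftharpoonup> h = (\<lambda>x. f (h * x))"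

text \<open>The antipode of a finite-dimensional Hopf algebra is bijective; this is not part of
  \<open>hopf_algebra\<close>.\<close>

abbreviation antipode_inv :: "('k::field, 'h::ring_1) hopf \<Rightarrow> 'h \<Rightarrow> 'h" where
  "antipode_inv H \<equiv> inv (antipode H)"

section \<open>The two-sided crossed product\<close>

text \<open>The space is bracketed as \<open>H\<^sup>* \<otimes> ((H \<otimes> H) \<otimes> H\<^sup>*)\<close>; the product is the bilinear
  extension of the formula on pure tensors.\<close>

type_synonym ('k, 'h) ytensor =
  "('k, 'h \<Rightarrow> 'k, ('k, ('k, 'h, 'h) tensor, 'h \<Rightarrow> 'k) tensor) tensor"

definition y_space :: "('k::field, 'h::ring_1) hopf \<Rightarrow> ('k, ('k, 'h) ytensor) vspace" where
  "y_space H =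
     tensor (dual_alg H) (tensor (tensor (hopf_alg H) (hopf_alg H)) (dual_alg H))"

definition y_elem :: "('k::field, 'h::ring_1) hopf \<Rightarrow>
    ('h \<Rightarrow> 'k) \<Rightarrow> 'h \<Rightarrow> 'h \<Rightarrow> ('h \<Rightarrow> 'k) \<Rightarrow> ('k, 'h) ytensor" where
  "y_elem H p h g q =
     (let A = hopf_alg H; D = dual_alg H; AA = tensor A A in
      pure_tensor D (tensor AA D) p (pure_tensor AA D (pure_tensor A A h g) q))"

definition y_lift :: "('k::field, 'h::ring_1) hopf \<Rightarrow>
    (('h \<Rightarrow> 'k) \<Rightarrow> 'h \<Rightarrow> 'h \<Rightarrow> ('h \<Rightarrow> 'k) \<Rightarrow> 'u::ab_group_add) \<Rightarrow> ('k, 'h) ytensor \<Rightarrow> 'u" where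
  "y_lift H F =
     (let A = hopf_alg H; D = dual_alg H; AA = tensor A A in
      tensor_lift D (tensor AA D) (\<lambda>p. tensor_lift AA D (\<lambda>t q. tensor_lift A A (\<lambda>h g. F p h g q) t)))"

definition y_mult :: "('k::field, 'h::ring_1) hopf \<Rightarrow>
    ('k, 'h) ytensor \<Rightarrow> ('k, 'h) ytensor \<Rightarrow> ('k, 'h) ytensor" where
  "y_mult H x x' =
     (let mu = amult (dual_alg H); S = antipode H; S' = antipode_inv H in
      y_lift H (\<lambda>p h g q. y_lift H (\<lambda>p' h' g' q'.
        sweedler2 H h (\<lambda>h1 h2. sweedler2 H g (\<lambda>g1 g2.
        sweedler2 H h' (\<lambda>h1' h2'. sweedler2 H g' (\<lambda>g1' g2'.
          y_elem H (mu p (h1 \<rightharpoonup> p' \<leftharpoonup> g1)) (h2 * h1') (g1' * g2)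
                   (mu q' (S h2' \<rightharpoonup> q \<leftharpoonup> S' g2'))))))) x') x)"

definition two_sided_crossed_product ::
  "('k::field, 'h::ring_1) hopf \<Rightarrow> ('k, ('k, 'h) ytensor) alg" where
  "two_sided_crossed_product H =
     \<lparr>carr = carr (y_space H), scal = scal (y_space H), amult = y_mult H,
      aone = y_elem H (aone (dual_alg H)) 1 1 (aone (dual_alg H))\<rparr>"

section \<open>The diagonal crossed product\<close>

type_synonym ('k, 'h) ztensor =
  "('k, ('k, 'h \<Rightarrow> 'k, 'h \<Rightarrow> 'k) tensor, ('k, 'h, 'h) tensor) tensor"

definition z_space :: "('k::field, 'h::ring_1) hopf \<Rightarrow> ('k, ('k, 'h) ztensor) vspace" where
  "z_space H =
     tensor (tensor (dual_alg H) (dual_alg H)) (tensor (hopf_alg H) (hopf_alg H))"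

definition z_elem :: "('k::field, 'h::ring_1) hopf \<Rightarrow>
    ('h \<Rightarrow> 'k) \<Rightarrow> ('h \<Rightarrow> 'k) \<Rightarrow> 'h \<Rightarrow> 'h \<Rightarrow> ('k, 'h) ztensor" where
  "z_elem H p q h g =
     (let A = hopf_alg H; D = dual_alg H in
      pure_tensor (tensor D D) (tensor A A) (pure_tensor D D p q) (pure_tensor A A h g))"

definition z_lift :: "('k::field, 'h::ring_1) hopf \<Rightarrow>
    (('h \<Rightarrow> 'k) \<Rightarrow> ('h \<Rightarrow> 'k) \<Rightarrow> 'h \<Rightarrow> 'h \<Rightarrow> 'u::ab_group_add) \<Rightarrow> ('k, 'h) ztensor \<Rightarrow> 'u" where
  "z_lift H F =
     (let A = hopf_alg H; D = dual_alg H in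
      tensor_lift (tensor D D) (tensor A A)
        (\<lambda>s t. tensor_lift D D (\<lambda>p q. tensor_lift A A (\<lambda>h g. F p q h g) t) s))"

definition z_mult :: "('k::field, 'h::ring_1) hopf \<Rightarrow>
    ('k, 'h) ztensor \<Rightarrow> ('k, 'h) ztensor \<Rightarrow> ('k, 'h) ztensor" where
  "z_mult H x x' =
     (let mu = amult (dual_alg H) in
      z_lift H (\<lambda>p q h g. z_lift H (\<lambda>p' q' h' g'.
        sweedler3 H h (\<lambda>h1 h2 h3. sweedler3 H g (\<lambda>g1 g2 g3.
          z_elem H (mu p (h1 \<rightharpoonup> p' \<leftharpoonup> g1)) (mu (h3 \<rightharpoonup> q' \<leftharpoonup> g3) q)
                   (h2 * h') (g' * g2)))) x') x)"

definition diagonal_crossed_product ::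
  "('k::field, 'h::ring_1) hopf \<Rightarrow> ('k, ('k, 'h) ztensor) alg" where
  "diagonal_crossed_product H =
     \<lparr>carr = carr (z_space H), scal = scal (z_space H), amult = z_mult H,
      aone = z_elem H (aone (dual_alg H)) (aone (dual_alg H)) 1 1\<rparr>"

end

(*
  Write K for the Hopf algebra H (x) H^op. Both products have the shape of a smash product with
  the K-module algebra H^*, acted on by (h, g).p = h -> p <- g. Associativity of Z is a direct
  Sweedler computation: both bracketings become a sum over five legs of k and three legs of k'.
  In the same calculus alpha(p # k # q) = p (x) k_2.q |><| k_1 is bijective and multiplicative, so
  the algebra axioms for Y follow from those for Z.

  The antipode of K is (S, S^{-1}), so S has to be bijective. The fundamental theorem of Hopf
  modules, made explicit for H^*, gives a nonzero form l with x_1 l(x_2) = l(x) 1, as a trace.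
  Then l(x S(h_1)) h_2 = x_1 l(x_2 S(h)), which vanishes for all x if S(h) = 0. Hence
  l(y) h = l(y S^2(h_2) S(h_1)) h_3 = 0 for all y, and therefore h = 0.
*)

theory Submission
  imports Defs
begin

section \<open>Linear maps\<close>

text \<open>The map \<open>alpha\<close> multiplies out an ordered word: in \<open>Z\<close> one has
  ((p \<otimes> 1) \<bowtie> k)((1 \<otimes> q) \<bowtie> 1) = (p \<otimes> k_2.q) \<bowtie> k_1,
  and \<open>beta\<close> moves q back past k with the antipode of K. The product of
  \<open>Z\<close> contains no antipode, so its associativity needs no cancellation; this is why
  \<open>Z\<close>, rather than \<open>Y\<close>, is checked directly. A Sweedler sum is evaluated
  on a chosen presentation, and only multilinearity of the summand makes the choice irrelevant.
  Hence every use of coassociativity carries linearity obligations, and much of the text serves to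
  make them mechanical. The square of S in the trace comes from the Hopf module structure of the
  dual of H. There h acts by (f.h)(x) = f(x S(h)), and the coaction, dual to left convolution, sends
  f to the sum over a basis of e_j \<otimes> j_1 f(j_2). The projection f_0.S(f_1) to the
  coinvariants therefore takes x to the sum of e_j(x S(S(j_1))) f(j_2).\<close>

lemma linear_mapI:
  assumes "\<And>x. x \<in> carr V \<Longrightarrow> f x \<in> carr W"
    and "\<And>x y. x \<in> carr V \<Longrightarrow> y \<in> carr V \<Longrightarrow> f (x + y) = f x + f y"
    and "\<And>c x. x \<in> carr V \<Longrightarrow> f (scal V c x) = scal W c (f x)"
  shows "linear_map V W f"
  using assms by (simp add: linear_map_def)

lemma linear_mapD:
  assumes "linear_map V W f" and "x \<in> carr V"
  shows "f x \<in> carr W"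
    and "y \<in> carr V \<Longrightarrow> f (x + y) = f x + f y"
    and "f (scal V c x) = scal W c (f x)"
  using assms by (auto simp: linear_map_def)

lemma linear_map_id: "linear_map V V (\<lambda>x. x)"
  by (simp add: linear_map_def)

lemma linear_map_comp:
  "linear_map V W g \<Longrightarrow> linear_map X V f \<Longrightarrow> linear_map X W (\<lambda>x. g (f x))"
  by (simp add: linear_map_def)

lemma bilinear_mapI:
  assumes "\<And>w. w \<in> carr W \<Longrightarrow> linear_map V U (\<lambda>v. b v w)"
    and "\<And>v. v \<in> carr V \<Longrightarrow> linear_map W U (b v)"
  shows "bilinear_map V W U b"
  using assms by (simp add: bilinear_map_def)

lemma bilinear_map_lin:
  assumes "bilinear_map V W U b"
  shows "w \<in> carr W \<Longrightarrow> linear_map V U (\<lambda>v. b v w)"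
    and "v \<in> carr V \<Longrightarrow> linear_map W U (b v)"
  using assms by (simp_all add: bilinear_map_def)

section \<open>Finite sums and fixed presentations\<close>

lemma sum_list_mem:
  assumes "k_vspace U" and "\<And>x. x \<in> set xs \<Longrightarrow> f x \<in> carr U"
  shows "(\<Sum>x\<leftarrow>xs. f x) \<in> carr U"
  using assms(2) by (induction xs) (auto simp: k_vspaceD[OF assms(1)])

lemma scal_sum_list:
  assumes "k_vspace U"
  shows "scal U c (\<Sum>x\<leftarrow>xs. f x) = (\<Sum>x\<leftarrow>xs. scal U c (f x))"
proof -
  interpret vector_space "scal U" using assms by (rule k_vspaceD)
  show ?thesis by (induction xs) (auto simp: scale_right_distrib)
qed

lemma linear_map_sum_list_fun:
  assumes U: "k_vspace U" and f: "\<And>i. i \<in> set xs \<Longrightarrow> linear_map X U (f i)"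
  shows "linear_map X U (\<lambda>x. \<Sum>i\<leftarrow>xs. f i x)"
proof (rule linear_mapI)
  fix x assume x: "x \<in> carr X"
  show "(\<Sum>i\<leftarrow>xs. f i x) \<in> carr U" by (rule sum_list_mem[OF U]) (use f x in \<open>auto dest: linear_mapD(1)\<close>)
  show "(\<Sum>i\<leftarrow>xs. f i (scal X c x)) = scal U c (\<Sum>i\<leftarrow>xs. f i x)" for c
    unfolding scal_sum_list[OF U]
    by (rule arg_cong[where f = sum_list], rule map_cong[OF refl]) (use f x in \<open>auto dest: linear_mapD(3)\<close>)
  fix y assume y: "y \<in> carr X"
  show "(\<Sum>i\<leftarrow>xs. f i (x + y)) = (\<Sum>i\<leftarrow>xs. f i x) + (\<Sum>i\<leftarrow>xs. f i y)"
    unfolding sum_list_addf[symmetric]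
    by (rule arg_cong[where f = sum_list], rule map_cong[OF refl]) (use f x y in \<open>auto dest: linear_mapD(2)\<close>)
qed

lemma presentation_carr:
  assumes "k_vspace V" and "t \<in> carr (tensor V W)"
  shows "set (presentation V W t) \<subseteq> carr V \<times> carr W"
  using someI_ex[OF tensor_presentation_exists[OF assms]] unfolding presentation_def by blast

text \<open>The presentation is chosen from \<open>t\<close> alone, so the lift is one fixed finite
  sum, linear in any parameter in which all its summands are linear.\<close>

lemma linear_map_tensor_lift_param:
  assumes "k_vspace V" "k_vspace U" and "t \<in> carr (tensor V W)"
    and "\<And>v w. v \<in> carr V \<Longrightarrow> w \<in> carr W \<Longrightarrow> linear_map X U (\<lambda>x. F x v w)"
  shows "linear_map X U (\<lambda>x. tensor_lift V W (F x) t)"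
  unfolding tensor_lift_def case_prod_beta
  by (rule linear_map_sum_list_fun[OF assms(2)])
     (use presentation_carr[OF assms(1,3)] assms(4) in auto)

lemma sum_list_swap:
  "(\<Sum>x\<leftarrow>xs. \<Sum>y\<leftarrow>ys. f x y) = (\<Sum>y\<leftarrow>ys. \<Sum>x\<leftarrow>xs. (f x y :: 'a::comm_monoid_add))"
  by (induction xs) (simp_all add: sum_list_addf)

section \<open>Sweedler calculus\<close>

locale hopf_structure =
  fixes H :: "('k::field, 'h::ring_1) hopf"
  assumes hopf: "hopf_algebra H"
begin

abbreviation "A \<equiv> hopf_alg H"
abbreviation "AA \<equiv> tensor A A"
abbreviation "sw \<equiv> sweedler2 H"
abbreviation "S \<equiv> antipode H"
abbreviation "\<epsilon> \<equiv> counit H"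

lemma carr_A [simp]: "carr A = UNIV" and scal_A [simp]: "scal A = hscale H"
  by (simp_all add: hopf_alg_def)

lemma carr_ground [simp]: "carr ground = UNIV" and scal_ground [simp]: "scal ground = (*)"
  by (simp_all add: ground_def)

lemma
  shows alg_A: "k_algebra A"
    and lin_comult: "linear_map A AA (comult H)"
    and lin_counit: "linear_map A ground \<epsilon>"
    and lin_antipode: "linear_map A A S"
    and coassoc_pure: "sw h (\<lambda>a c. sw a (\<lambda>x y. pure_tensor A AA x (pure_tensor A A y c))) =
      sw h (\<lambda>a c. sw c (\<lambda>x y. pure_tensor A AA a (pure_tensor A A x y)))"
    and counit_l: "sw h (\<lambda>a b. hscale H (\<epsilon> a) b) = h"
    and counit_r: "sw h (\<lambda>a b. hscale H (\<epsilon> b) a) = h"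
    and comult_mult: "comult H (x * y) =
      sw x (\<lambda>x1 x2. sw y (\<lambda>y1 y2. pure_tensor A A (x1 * y1) (x2 * y2)))"
    and comult_one: "comult H 1 = pure_tensor A A 1 1"
    and counit_mult: "\<epsilon> (x * y) = \<epsilon> x * \<epsilon> y"
    and counit_one [simp]: "\<epsilon> 1 = 1"
    and antipode_l: "sw h (\<lambda>a b. S a * b) = hscale H (\<epsilon> h) 1"
    and antipode_r: "sw h (\<lambda>a b. a * S b) = hscale H (\<epsilon> h) 1"
  using hopf unfolding hopf_algebra_def Let_def by blast+

lemma vs_A: "k_vspace A"
  using alg_A by (simp add: k_algebra_def)

lemmas vs_AA = k_vspace_tensor[of A A]

lemma lin_mult_l: "linear_map A A (\<lambda>x. x * c)" and lin_mult_r: "linear_map A A (\<lambda>x. c * x)"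
proof -
  have "bilinear_map A A A (*)"
    using alg_A by (simp add: k_algebra_def) (simp add: hopf_alg_def)
  then show "linear_map A A (\<lambda>x. x * c)" "linear_map A A (\<lambda>x. c * x)"
    by (auto dest: bilinear_map_lin)
qed

lemma sw_list: "sw h F = (\<Sum>p\<leftarrow>presentation A A (comult H h). F (fst p) (snd p))"
  by (simp add: sweedler2_def tensor_lift_def case_prod_unfold)

text \<open>Both sides are the same double sum over two chosen presentations, so the exchange holds
  for any \<open>F\<close>.\<close>

lemma sw_swap: "sw h (\<lambda>a b. sw g (\<lambda>c d. F a b c d)) = sw g (\<lambda>c d. sw h (\<lambda>a b. F a b c d))"
  unfolding sw_list by (rule sum_list_swap)

lemma sw_mem: "k_vspace U \<Longrightarrow> (\<And>a b. F a b \<in> carr U) \<Longrightarrow> sw h F \<in> carr U"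
  unfolding sw_list by (rule sum_list_mem)

lemma sw_hom:
  assumes U: "k_vspace U" and W: "k_vspace W" and f: "linear_map U W f"
    and F: "\<And>a b. F a b \<in> carr U"
  shows "f (sw h F) = sw h (\<lambda>a b. f (F a b))"
  using linear_map_sum_list[OF U W f, of "map (\<lambda>p. F (fst p) (snd p)) (presentation A A (comult H h))"] F
  unfolding sw_list by (auto simp: comp_def)

lemma sw_apply: "sw h F x = sw h (\<lambda>a b. F a b x)"
  unfolding sw_list by (rule sum_list_apply)

text \<open>Here the parameter sits in the summand. In \<open>lin_sw\<close> it sits in the element
  that is split, and linearity comes from the universal property of the tensor product.\<close>

lemma lin_sw_param:
  assumes "k_vspace U" "\<And>a b. linear_map X U (\<lambda>x. F x a b)"
  shows "linear_map X U (\<lambda>x. sw h (F x))"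
  unfolding sw_list by (rule linear_map_sum_list_fun[OF assms(1)]) (rule assms(2))

lemma lin_sw:
  assumes U: "k_vspace U" and f: "linear_map X A f"
    and F: "\<And>b. linear_map A U (\<lambda>a. F a b)" "\<And>a. linear_map A U (F a)"
  shows "linear_map X U (\<lambda>x. sw (f x) F)"
  unfolding sweedler2_def
  by (intro linear_map_comp[OF linear_map_tensor_lift[OF vs_A U] linear_map_comp[OF lin_comult f]]
    bilinear_mapI F)

text \<open>The Hopf axiom expresses coassociativity through pure tensors. A trilinear
  \<open>F\<close> factors through the linear map \<open>L\<close> on the triple tensor product, and
  \<open>L\<close> carries the axiom over to \<open>F\<close>.\<close>

lemma sw_coassoc:
  assumes U: "k_vspace U"
    and F: "\<And>b c. linear_map A U (\<lambda>a. F a b c)" "\<And>a c. linear_map A U (\<lambda>b. F a b c)"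
      "\<And>a b. linear_map A U (\<lambda>c. F a b c)"
  shows "sw h (\<lambda>a c. sw a (\<lambda>x y. F x y c)) = sw h (\<lambda>a c. sw c (\<lambda>x y. F a x y))"
proof -
  have bil: "bilinear_map A A U (F x)" for x by (intro bilinear_mapI F)
  define L where "L = tensor_lift A AA (\<lambda>x. tensor_lift A A (F x))"
  have b2: "bilinear_map A AA U (\<lambda>x. tensor_lift A A (F x))"
    by (intro bilinear_mapI linear_map_tensor_lift vs_A U bil linear_map_tensor_lift_param F)
  have L: "linear_map (tensor A AA) U L"
    unfolding L_def by (intro linear_map_tensor_lift vs_A U b2)
  have Lp: "L (pure_tensor A AA x (pure_tensor A A y z)) = F x y z" for x y z
    unfolding L_def by (simp add: tensor_lift_pure[OF U b2] tensor_lift_pure[OF U bil] pure_tensor_mem)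
  have "L (sw h (\<lambda>a c. sw a (\<lambda>x y. pure_tensor A AA x (pure_tensor A A y c)))) =
      L (sw h (\<lambda>a c. sw c (\<lambda>x y. pure_tensor A AA a (pure_tensor A A x y))))"
    by (simp only: coassoc_pure)
  then show ?thesis
    by (simp add: sw_hom[OF k_vspace_tensor U L] sw_mem k_vspace_tensor pure_tensor_mem Lp)
qed

lemma sw_counit_l:
  assumes U: "k_vspace U" and f: "linear_map A U f"
  shows "sw h (\<lambda>a b. scal U (\<epsilon> a) (f b)) = f h"
  using sw_hom[OF vs_A U f, of "\<lambda>a b. hscale H (\<epsilon> a) b" h] linear_mapD(3)[OF f]
  by (simp add: counit_l)

lemma sw_counit_r:
  assumes U: "k_vspace U" and f: "linear_map A U f"
  shows "sw h (\<lambda>a b. scal U (\<epsilon> b) (f a)) = f h"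
  using sw_hom[OF vs_A U f, of "\<lambda>a b. hscale H (\<epsilon> b) a" h] linear_mapD(3)[OF f]
  by (simp add: counit_r)

lemma sw_mult:
  assumes U: "k_vspace U"
    and F: "\<And>b. linear_map A U (\<lambda>a. F a b)" "\<And>a. linear_map A U (F a)"
  shows "sw (x * y) F = sw x (\<lambda>x1 x2. sw y (\<lambda>y1 y2. F (x1 * y1) (x2 * y2)))"
proof -
  have bil: "bilinear_map A A U F" by (intro bilinear_mapI F)
  note L = linear_map_tensor_lift[OF vs_A U bil]
  show ?thesis
    unfolding sweedler2_def[of H "x * y"] comult_mult
    by (simp add: sw_hom[OF k_vspace_tensor U L] sw_mem k_vspace_tensor pure_tensor_mem
        tensor_lift_pure[OF U bil])
qed

lemma sw_one:
  assumes U: "k_vspace U"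
    and F: "\<And>b. linear_map A U (\<lambda>a. F a b)" "\<And>a. linear_map A U (F a)"
  shows "sw 1 F = F 1 1"
  unfolding sweedler2_def comult_one
  by (rule tensor_lift_pure[OF U]) (auto intro!: bilinear_mapI F)

lemma sw_antipode_r:
  assumes U: "k_vspace U" and f: "linear_map A U f"
  shows "sw h (\<lambda>a b. f (a * S b)) = scal U (\<epsilon> h) (f 1)"
  using sw_hom[OF vs_A U f, of "\<lambda>a b. a * S b" h] linear_mapD(3)[OF f, of 1]
  by (simp add: antipode_r)

text \<open>If the bound variable of a function occurs only once in its body, then at most one of these
  rules unifies with the goal, so \<open>intro\<close> proves multilinearity without search.\<close>

lemmas linA_intros =
  linear_map_id
  linear_map_comp[OF lin_antipode]
  linear_map_comp[OF lin_counit]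
  linear_map_comp[OF lin_mult_l] linear_map_comp[OF lin_mult_r]
  lin_sw_param lin_sw vs_A k_vspace_ground

lemma lin_hscale_l: "linear_map X ground f \<Longrightarrow> linear_map X A (\<lambda>x. hscale H (f x) v)"
  and lin_hscale_r: "linear_map X A g \<Longrightarrow> linear_map X A (\<lambda>x. hscale H c (g x))"
proof -
  interpret vector_space "hscale H" using k_vspaceD(1)[OF vs_A] by simp
  show "linear_map X ground f \<Longrightarrow> linear_map X A (\<lambda>x. hscale H (f x) v)"
    "linear_map X A g \<Longrightarrow> linear_map X A (\<lambda>x. hscale H c (g x))"
    by (auto simp: linear_map_def scale_left_distrib scale_right_distrib mult.commute)
qed

lemma lin_ground_l: "linear_map X ground f \<Longrightarrow> linear_map X ground (\<lambda>x. f x * c)"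
  and lin_ground_r: "linear_map X ground f \<Longrightarrow> linear_map X ground (\<lambda>x. c * f x)"
  by (auto simp: linear_map_def algebra_simps)

lemmas linS_intros = linA_intros lin_hscale_l lin_hscale_r lin_ground_l lin_ground_r

text \<open>\<open>T\<close> stands for either S(c) d or c S(d). The pair contracts to \<epsilon>(b)
  1, and the counit law then removes the leg b.\<close>

lemma sw_cancel_r:
  assumes U: "k_vspace U" and T: "\<And>h. sw h T = hscale H (\<epsilon> h) 1"
    and G: "\<And>b. linear_map A U (\<lambda>a. G a b)" "\<And>a. linear_map A U (G a)"
  shows "sw h (\<lambda>a b. sw b (\<lambda>c d. G a (T c d))) = G h 1"
proof -
  have "sw b (\<lambda>c d. G a (T c d)) = scal U (\<epsilon> b) (G a 1)" for a b
    using sw_hom[OF vs_A U G(2), of "\<lambda>c d. T c d" a b] linear_mapD(3)[OF G(2), of 1 a "\<epsilon> b"] by (simp add: T)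
  then show ?thesis using sw_counit_r[OF U G(1)] by simp
qed

lemma sw_cancel_l:
  assumes U: "k_vspace U" and T: "\<And>h. sw h T = hscale H (\<epsilon> h) 1"
    and G: "\<And>b. linear_map A U (\<lambda>a. G a b)" "\<And>a. linear_map A U (G a)"
  shows "sw h (\<lambda>a b. sw a (\<lambda>c d. G b (T c d))) = G h 1"
proof -
  have "sw a (\<lambda>c d. G b (T c d)) = scal U (\<epsilon> a) (G b 1)" for a b
    using sw_hom[OF vs_A U G(2), of "\<lambda>c d. T c d" b a] linear_mapD(3)[OF G(2), of 1 b "\<epsilon> a"] by (simp add: T)
  then show ?thesis using sw_counit_l[OF U G(1)] by simp
qed

section \<open>The antipode is an antihomomorphism\<close>

lemma antipode_one: "S 1 = 1"
proof -
  interpret vector_space "hscale H" using k_vspaceD(1)[OF vs_A] by simp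
  have "sw 1 (\<lambda>a b. S a * b) = S 1 * 1"
    by (rule sw_one[OF vs_A]) (intro linS_intros)+
  then show ?thesis by (simp add: antipode_l)
qed

text \<open>Both sides are convolution inverses of the multiplication, as maps on H \<otimes> H.
  Explicitly, \<open>F\<close> is contracted in two ways: its last factors collapse and leave S(y)
  S(x), or its first factors collapse and leave S(x y).\<close>

lemma antipode_mult: "S (x * y) = S y * S x"
proof -
  define F where "F x1 x2 x3 y1 y2 y3 = S y1 * S x1 * ((x2 * y2) * S (x3 * y3))"
    for x1 x2 x3 y1 y2 y3 :: 'h
  have "sw x (\<lambda>x1 x'. sw x' (\<lambda>x2 x3. sw y (\<lambda>y1 y'. sw y' (\<lambda>y2 y3. F x1 x2 x3 y1 y2 y3)))) = S y * S x"
  proof -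
    have "sw x' (\<lambda>x2 x3. sw y (\<lambda>y1 y'. sw y' (\<lambda>y2 y3. F x1 x2 x3 y1 y2 y3))) =
        hscale H (\<epsilon> x') (S y * S x1)" for x1 x'
    proof -
      have "sw x' (\<lambda>x2 x3. sw y (\<lambda>y1 y'. sw y' (\<lambda>y2 y3. F x1 x2 x3 y1 y2 y3))) =
          sw y (\<lambda>y1 y'. sw x' (\<lambda>x2 x3. sw y' (\<lambda>y2 y3. F x1 x2 x3 y1 y2 y3)))"
        by (rule sw_swap)
      also have "\<dots> = sw y (\<lambda>y1 y'. sw (x' * y') (\<lambda>u v. S y1 * S x1 * (u * S v)))"
        unfolding F_def
        by (subst sw_mult[OF vs_A]) (intro linS_intros, intro linS_intros, rule refl)
      also have "\<dots> = sw y (\<lambda>y1 y'. scal A (\<epsilon> (x' * y')) (S y1 * S x1 * 1))"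
        by (subst sw_antipode_r[OF vs_A]) (intro linS_intros, rule refl)
      also have "\<dots> = sw y (\<lambda>y1 y'. scal A (\<epsilon> y') (hscale H (\<epsilon> x') (S y1 * S x1)))"
      proof -
        interpret vector_space "hscale H" using k_vspaceD(1)[OF vs_A] by simp
        show ?thesis by (simp add: counit_mult mult.commute)
      qed
      also have "\<dots> = hscale H (\<epsilon> x') (S y * S x1)"
        by (rule sw_counit_r[OF vs_A]) (intro linS_intros)
      finally show ?thesis .
    qed
    then show ?thesis
      using sw_counit_r[OF vs_A, of "\<lambda>x. S y * S x" x] by (simp add: linear_map_comp[OF lin_mult_r lin_antipode])
  qed
  moreover have "sw x (\<lambda>x1 x'. sw x' (\<lambda>x2 x3. sw y (\<lambda>y1 y'. sw y' (\<lambda>y2 y3. F x1 x2 x3 y1 y2 y3)))) = S (x * y)"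
  proof -
    have "sw x (\<lambda>x1 x'. sw x' (\<lambda>x2 x3. sw y (\<lambda>y1 y'. sw y' (\<lambda>y2 y3. F x1 x2 x3 y1 y2 y3)))) =
       sw x (\<lambda>x' x3. sw x' (\<lambda>x1 x2. sw y (\<lambda>y1 y'. sw y' (\<lambda>y2 y3. F x1 x2 x3 y1 y2 y3))))"
      unfolding F_def by (rule sw_coassoc[OF vs_A, symmetric]) (intro linS_intros)+
    also have "\<dots> = sw x (\<lambda>x' x3. sw x' (\<lambda>x1 x2. sw y (\<lambda>y' y3. sw y' (\<lambda>y1 y2. F x1 x2 x3 y1 y2 y3))))"
      unfolding F_def by (subst sw_coassoc[OF vs_A]) (intro linS_intros, intro linS_intros, intro linS_intros, rule refl)
    also have "\<dots> = sw x (\<lambda>x' x3. sw x' (\<lambda>x1 x2. sw y (\<lambda>y' y3. sw y' (\<lambda>y1 y2. S y1 * ((S x1 * x2) * y2) * S (x3 * y3)))))"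
      unfolding F_def by (simp add: mult.assoc)
    also have "\<dots> = sw y (\<lambda>y' y3. sw y' (\<lambda>y1 y2. S y1 * (1 * y2) * S (x * y3)))"
      by (rule sw_cancel_l[OF vs_A antipode_l]) (intro linS_intros)+
    also have "\<dots> = sw y (\<lambda>y' y3. sw y' (\<lambda>y1 y2. (S y1 * y2) * S (x * y3)))"
      by simp
    also have "\<dots> = 1 * S (x * y)"
      by (rule sw_cancel_l[OF vs_A antipode_l]) (intro linS_intros)+
    finally show ?thesis by simp
  qed
  ultimately show ?thesis by simp
qed

text \<open>The coproduct of S(h) and S(h_2) \<otimes> S(h_1) are both convolution inverses of the
  coproduct, as maps from H to H \<otimes> H.\<close>

lemma sw_antipode:
  assumes U: "k_vspace U"
    and F: "\<And>b. linear_map A U (\<lambda>a. F a b)" "\<And>a. linear_map A U (F a)"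
  shows "sw (S h) F = sw h (\<lambda>a b. F (S b) (S a))"
proof -
  note I = linS_intros linear_map_comp[OF F(1)] linear_map_comp[OF F(2)] U
  \<comment> \<open>In \<open>K\<close> the products S(c) s and S(a) t are not yet contracted.
    Putting c = s = 1 records that the first of them has collapsed.\<close>
  define K where "K a c s t i = sw (S i) (\<lambda>u v. F ((S c * s) * u) ((S a * t) * v))" for a c s t i
  have step: "F (S b) (S a) = sw b (\<lambda>t i. K a 1 1 t i)" for a b
  proof -
    have "F (S b) (S a) = sw 1 (\<lambda>u v. F (S b * u) (S a * v))"
      using sw_one[OF U, of "\<lambda>u v. F (S b * u) (S a * v)"] by (simp add: I)
    \<comment> \<open>The unit is written as e S(i) with two new legs of b, so that its coproduct
      becomes that of e times that of S(i).\<close>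
    also have "\<dots> = sw b (\<lambda>c d. sw d (\<lambda>e i. sw (e * S i) (\<lambda>u v. F (S c * u) (S a * v))))"
      by (rule sw_cancel_r[OF U antipode_r, symmetric]) (intro I)+
    also have "\<dots> = sw b (\<lambda>c d. sw d (\<lambda>e i. sw e (\<lambda>s t. K a c s t i)))"
      unfolding K_def
      by (subst sw_mult[OF U]) (intro I, intro I, simp only: mult.assoc)
    also have "\<dots> = sw b (\<lambda>c d. sw d (\<lambda>s e. sw e (\<lambda>t i. K a c s t i)))"
      unfolding K_def by (subst sw_coassoc[OF U]) (intro I, intro I, intro I, rule refl)
    also have "\<dots> = sw b (\<lambda>p e. sw p (\<lambda>c s. sw e (\<lambda>t i. K a c s t i)))"
      unfolding K_def by (rule sw_coassoc[OF U, symmetric]) (intro I)+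
    also have "\<dots> = sw b (\<lambda>t i. sw (S i) (\<lambda>u v. F (1 * u) ((S a * t) * v)))"
      unfolding K_def by (rule sw_cancel_l[OF U antipode_l]) (intro I)+
    finally show ?thesis by (simp add: K_def antipode_one)
  qed
  have "sw h (\<lambda>a b. F (S b) (S a)) = sw h (\<lambda>a b. sw b (\<lambda>t i. K a 1 1 t i))"
    by (simp only: step)
  also have "\<dots> = sw h (\<lambda>p i. sw p (\<lambda>a t. K a 1 1 t i))"
    unfolding K_def by (rule sw_coassoc[OF U, symmetric]) (intro I)+
  also have "\<dots> = sw (S h) (\<lambda>u v. F (S 1 * 1 * u) (1 * v))"
    unfolding K_def by (rule sw_cancel_l[OF U antipode_l]) (intro I)+
  finally show ?thesis by (simp add: antipode_one)
qed

end

section \<open>Bijectivity of the antipode\<close>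

locale fd_hopf_structure = hopf_structure H for H :: "('k::field, 'h::ring_1) hopf" +
  fixes Basis :: "'h set"
  assumes fd: "finite_dimensional_vector_space (hscale H) Basis"
begin

lemma dual_basis:
  obtains bs e where "\<And>b. linear_map A ground (e b)" "\<And>x. (\<Sum>b\<leftarrow>bs. hscale H (e b x) b) = x"
proof -
  interpret finite_dimensional_vector_space "hscale H" Basis by (rule fd)
  obtain bs where bs: "set bs = Basis" "distinct bs"
    using finite_distinct_list[OF finite_Basis] by blast
  define e where "e = (\<lambda>b x. representation Basis x b)"
  show ?thesis
  proof
    show "linear_map A ground (e b)" for b
      unfolding e_def
      by (rule linear_mapI) (simp_all add: representation_add representation_scale independent_Basis span_Basis)
    show "(\<Sum>b\<leftarrow>bs. hscale H (e b x) b) = x" for x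
      using sum_representation_eq[OF independent_Basis, of x Basis] bs
      by (simp add: e_def sum_list_distinct_conv_sum_set span_Basis finite_Basis)
  qed
qed

section \<open>The projection of the dual to its coinvariants\<close>

context
  fixes bs :: "'h list" and e :: "'h \<Rightarrow> 'h \<Rightarrow> 'k"
  assumes lin_e: "\<And>b. linear_map A ground (e b)"
    and e_expand: "\<And>x. (\<Sum>b\<leftarrow>bs. hscale H (e b x) b) = x"
begin

text \<open>Used in both directions: an element is spread over the basis, or a basis sum carrying a
  coordinate functional is collapsed to one evaluation.\<close>

lemma expand:
  assumes U: "k_vspace U" and f: "linear_map A U f"
  shows "(\<Sum>b\<leftarrow>bs. scal U (e b x) (f b)) = f x"
proof -
  have "f (\<Sum>b\<leftarrow>bs. hscale H (e b x) b) = (\<Sum>b\<leftarrow>bs. f (hscale H (e b x) b))"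
    using linear_map_sum_list[OF vs_A U f, of "map (\<lambda>b. hscale H (e b x) b) bs"]
    by (simp add: comp_def)
  then show ?thesis
    using linear_mapD(3)[OF f] by (simp add: e_expand)
qed

lemma sw_sum_list: "sw h (\<lambda>a b. \<Sum>i\<leftarrow>is. F i a b) = (\<Sum>i\<leftarrow>is. sw h (F i))"
  unfolding sw_list by (rule sum_list_swap)

text \<open>The trace of the operator that sends \<open>y\<close> to \<open>x S\<^sup>2(y\<^sub>1) f(y\<^sub>2)\<close>. As a function of \<open>x\<close> this is
  the projection of \<open>f\<close> to the coinvariants of the Hopf module \<open>H\<^sup>*\<close>.\<close>

definition integral_of :: "('h \<Rightarrow> 'k) \<Rightarrow> 'h \<Rightarrow> 'k" where
  "integral_of f x = (\<Sum>i\<leftarrow>bs. sw i (\<lambda>a b. e i (x * S (S a)) * f b))"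

lemmas linE_intros = linS_intros linear_map_comp[OF lin_e] linear_map_sum_list_fun

lemma lin_integral_of: "linear_map A ground f \<Longrightarrow> linear_map A ground (integral_of f)"
  unfolding integral_of_def by (intro linE_intros)

lemma hscale_hscale: "hscale H a (hscale H b x) = hscale H (a * b) x"
proof -
  interpret vector_space "hscale H" using k_vspaceD(1)[OF vs_A] by simp
  show ?thesis by simp
qed

lemma hscale_sum: "hscale H (\<Sum>i\<leftarrow>is. f i) x = (\<Sum>i\<leftarrow>is. hscale H (f i) x)"
proof -
  interpret vector_space "hscale H" using k_vspaceD(1)[OF vs_A] by simp
  show ?thesis by (induction "is") (simp_all add: scale_left_distrib)
qed

lemma hscale_sw: "hscale H (sw h F) x = sw h (\<lambda>a b. hscale H (F a b) x)"
  unfolding sw_list by (rule hscale_sum)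

text \<open>This is cyclicity of the trace. The element x S(S(c)) is expanded over a second basis
  index j, after which the original sum over i collapses to the second leg of j. The first leg of j
  then meets an antipode and cancels, leaving the unit.\<close>

lemma integral_of_coinvariant:
  assumes f: "linear_map A ground f"
  shows "sw x (\<lambda>x1 x2. hscale H (integral_of f x2) x1) = hscale H (integral_of f x) 1"
proof -
  note I = linE_intros linear_map_comp[OF f] vs_A
  \<comment> \<open>A trivial factor S(a S(c_1)) is inserted. As S reverses products, it turns x_1
    into x_1 S(S(c_1)) S(a), and S applied twice respects the coproduct, so x_1 S(S(c_1)) is the
    first leg of x S(S(c)).\<close>
  have 1: "sw x (\<lambda>x1 x2. sw i (\<lambda>a b. hscale H (e i (x2 * S (S a)) * f b) x1)) =
      sw i (\<lambda>a r. sw r (\<lambda>c b. sw (x * S (S c)) (\<lambda>z1 z2. hscale H (e i z2 * f b) (z1 * S a))))"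
    (is "?L = ?R") for i
  proof -
    define K where "K a c1 c2 b = sw x (\<lambda>x1 x2. hscale H (e i (x2 * S (S c2)) * f b) (x1 * S (a * S c1)))"
      for a c1 c2 b
    have "sw (x * S (S c)) (\<lambda>z1 z2. hscale H (e i z2 * f b) (z1 * S a)) = sw c (\<lambda>c1 c2. K a c1 c2 b)" for a b c
    proof -
      have "sw (x * S (S c)) (\<lambda>z1 z2. hscale H (e i z2 * f b) (z1 * S a)) =
          sw (S (S c)) (\<lambda>y1 y2. sw x (\<lambda>x1 x2. hscale H (e i (x2 * y2) * f b) (x1 * y1 * S a)))"
        by (subst sw_mult[OF vs_A]) (intro I, intro I, rule sw_swap)
      also have "\<dots> = sw c (\<lambda>c1 c2. sw x (\<lambda>x1 x2. hscale H (e i (x2 * S (S c2)) * f b) (x1 * S (S c1) * S a)))"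
        by (subst sw_antipode[OF vs_A], intro I, intro I, subst sw_antipode[OF vs_A], intro I, intro I, rule refl)
      finally show ?thesis by (simp add: K_def antipode_mult mult.assoc)
    qed
    then have "?R = sw i (\<lambda>a r. sw r (\<lambda>c b. sw c (\<lambda>c1 c2. K a c1 c2 b)))" by simp
    also have "\<dots> = sw i (\<lambda>a r. sw r (\<lambda>c1 s. sw s (\<lambda>c2 b. K a c1 c2 b)))"
      unfolding K_def by (subst sw_coassoc[OF vs_A]) (intro I, intro I, intro I, rule refl)
    also have "\<dots> = sw i (\<lambda>p s. sw p (\<lambda>a c1. sw s (\<lambda>c2 b. K a c1 c2 b)))"
      unfolding K_def by (rule sw_coassoc[OF vs_A, symmetric]) (intro I)+
    also have "\<dots> = sw i (\<lambda>c2 b. sw x (\<lambda>x1 x2. hscale H (e i (x2 * S (S c2)) * f b) (x1 * S 1)))"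
      unfolding K_def by (rule sw_cancel_l[OF vs_A antipode_r]) (intro I)+
    also have "\<dots> = ?L" unfolding antipode_one mult_1_right by (rule sw_swap)
    finally show ?thesis ..
  qed
  \<comment> \<open>The coproduct of x S(S(c)) becomes that of j; x survives only inside the
    coordinate e_j.\<close>
  have 2: "sw (x * S (S c)) (\<lambda>z1 z2. hscale H (e i z2 * f b) (z1 * S a)) =
      (\<Sum>j\<leftarrow>bs. sw j (\<lambda>z1 z2. hscale H (e i z2) (hscale H (e j (x * S (S c)) * f b) (z1 * S a))))" for a b c i
  proof -
    have "linear_map A A (\<lambda>z. sw z (\<lambda>z1 z2. hscale H (e i z2 * f b) (z1 * S a)))" by (intro I)
    from expand[OF vs_A this, of "x * S (S c)"]
    have "sw (x * S (S c)) (\<lambda>z1 z2. hscale H (e i z2 * f b) (z1 * S a)) =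
      (\<Sum>j\<leftarrow>bs. hscale H (e j (x * S (S c))) (sw j (\<lambda>z1 z2. hscale H (e i z2 * f b) (z1 * S a))))" by simp
    moreover have "hscale H c' (sw j (\<lambda>z1 z2. hscale H (e i z2 * f b) (z1 * S a))) =
      sw j (\<lambda>z1 z2. hscale H (e i z2) (hscale H (c' * f b) (z1 * S a)))" for c' j
      using sw_hom[OF vs_A vs_A lin_hscale_r[OF linear_map_id, of c']]
      by (simp add: hscale_hscale mult.left_commute)
    ultimately show ?thesis by simp
  qed
  have "sw x (\<lambda>x1 x2. hscale H (integral_of f x2) x1) =
      (\<Sum>i\<leftarrow>bs. sw x (\<lambda>x1 x2. sw i (\<lambda>a b. hscale H (e i (x2 * S (S a)) * f b) x1)))"
    by (simp only: integral_of_def hscale_sum hscale_sw sw_sum_list)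
  also have "\<dots> = (\<Sum>i\<leftarrow>bs. sw i (\<lambda>a r. sw r (\<lambda>c b. \<Sum>j\<leftarrow>bs. sw j (\<lambda>z1 z2.
      hscale H (e i z2) (hscale H (e j (x * S (S c)) * f b) (z1 * S a))))))"
    by (simp only: 1 2)
  also have "\<dots> = (\<Sum>i\<leftarrow>bs. \<Sum>j\<leftarrow>bs. sw j (\<lambda>z1 z2. hscale H (e i z2) (sw i (\<lambda>a r. sw r (\<lambda>c b.
      hscale H (e j (x * S (S c)) * f b) (z1 * S a))))))"
  proof -
    have "sw i (\<lambda>a r. sw r (\<lambda>c b. sw j (\<lambda>z1 z2.
        hscale H (e i z2) (hscale H (e j (x * S (S c)) * f b) (z1 * S a))))) =
      sw j (\<lambda>z1 z2. hscale H (e i z2) (sw i (\<lambda>a r. sw r (\<lambda>c b.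
        hscale H (e j (x * S (S c)) * f b) (z1 * S a)))))" for i j
    proof -
      have "hscale H c' (sw i (\<lambda>a r. sw r (F a))) = sw i (\<lambda>a r. sw r (\<lambda>c b. hscale H c' (F a c b)))"
        for c' and F :: "'h \<Rightarrow> 'h \<Rightarrow> 'h \<Rightarrow> 'h"
        by (simp add: sw_hom[OF vs_A vs_A lin_hscale_r[OF linear_map_id, of c']])
      then have "sw j (\<lambda>z1 z2. hscale H (e i z2) (sw i (\<lambda>a r. sw r (\<lambda>c b.
          hscale H (e j (x * S (S c)) * f b) (z1 * S a))))) =
        sw j (\<lambda>z1 z2. sw i (\<lambda>a r. sw r (\<lambda>c b. hscale H (e i z2)
          (hscale H (e j (x * S (S c)) * f b) (z1 * S a)))))" by (simp only:)
      also have "\<dots> = sw i (\<lambda>a r. sw j (\<lambda>z1 z2. sw r (\<lambda>c b. hscale H (e i z2)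
          (hscale H (e j (x * S (S c)) * f b) (z1 * S a)))))" by (rule sw_swap)
      also have "\<dots> = sw i (\<lambda>a r. sw r (\<lambda>c b. sw j (\<lambda>z1 z2. hscale H (e i z2)
          (hscale H (e j (x * S (S c)) * f b) (z1 * S a)))))" by (subst sw_swap) (rule refl)
      finally show ?thesis ..
    qed
    then show ?thesis by (simp only: sw_sum_list)
  qed
  also have "\<dots> = (\<Sum>j\<leftarrow>bs. sw j (\<lambda>z1 z2. \<Sum>i\<leftarrow>bs. hscale H (e i z2) (sw i (\<lambda>a r. sw r (\<lambda>c b.
      hscale H (e j (x * S (S c)) * f b) (z1 * S a))))))"
    unfolding sw_sum_list by (rule sum_list_swap)
  \<comment> \<open>The sum over i is the basis expansion of the second leg of j, so i is replaced
    by that leg.\<close>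
  also have "\<dots> = (\<Sum>j\<leftarrow>bs. sw j (\<lambda>z1 z2. sw z2 (\<lambda>a r. sw r (\<lambda>c b.
      hscale H (e j (x * S (S c)) * f b) (z1 * S a)))))"
  proof -
    have "linear_map A A (\<lambda>i. sw i (\<lambda>a r. sw r (\<lambda>c b. hscale H (e j (x * S (S c)) * f b) (z1 * S a))))"
      for j z1 by (intro I)
    from expand[OF vs_A this] show ?thesis by simp
  qed
  also have "\<dots> = (\<Sum>j\<leftarrow>bs. sw j (\<lambda>p r. sw p (\<lambda>z1 a. sw r (\<lambda>c b.
      hscale H (e j (x * S (S c)) * f b) (z1 * S a)))))"
    by (subst sw_coassoc[OF vs_A]) (intro I, intro I, intro I, rule refl)
  also have "\<dots> = (\<Sum>j\<leftarrow>bs. sw j (\<lambda>c b. hscale H (e j (x * S (S c)) * f b) 1))"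
    by (subst sw_cancel_l[OF vs_A antipode_r]) (intro I, intro I, rule refl)
  also have "\<dots> = hscale H (integral_of f x) 1"
    by (simp only: integral_of_def hscale_sum hscale_sw)
  finally show ?thesis .
qed

text \<open>This is the decomposition of f as the sum of P(f_0).f_1 in the fundamental theorem, with
  P = \<open>integral_of\<close>. After the sum over j has collapsed, the antipodes meet as S(a)
  S(S(c)) = S(S(c) a), which contracts.\<close>

lemma integral_of_recover:
  assumes f: "linear_map A ground f"
  shows "(\<Sum>j\<leftarrow>bs. sw j (\<lambda>a b. integral_of (e j) (x * S a) * f b)) = f x"
proof -
  note I = linE_intros linear_map_comp[OF f] k_vspace_ground
  have "(\<Sum>j\<leftarrow>bs. sw j (\<lambda>a b. integral_of (e j) (x * S a) * f b)) =
      (\<Sum>j\<leftarrow>bs. \<Sum>i\<leftarrow>bs. sw i (\<lambda>c d. e j d * sw j (\<lambda>a b. e i (x * S a * S (S c)) * f b)))"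
  proof -
    have "integral_of (e j) (x * S a) * f b =
        (\<Sum>i\<leftarrow>bs. sw i (\<lambda>c d. e j d * (e i (x * S a * S (S c)) * f b)))" for j a b
      unfolding integral_of_def sw_list sum_list_mult_const[symmetric] by (simp add: algebra_simps)
    moreover have "e j d * sw j F = sw j (\<lambda>a b. e j d * F a b)" for j d F
      unfolding sw_list by (simp add: sum_list_const_mult)
    ultimately show ?thesis by (simp only: sw_sum_list) (subst sw_swap, rule refl)
  qed
  also have "\<dots> = (\<Sum>i\<leftarrow>bs. sw i (\<lambda>c d. \<Sum>j\<leftarrow>bs. e j d * sw j (\<lambda>a b. e i (x * S a * S (S c)) * f b)))"
    unfolding sw_sum_list by (rule sum_list_swap)
  also have "\<dots> = (\<Sum>i\<leftarrow>bs. sw i (\<lambda>c d. sw d (\<lambda>a b. e i (x * S a * S (S c)) * f b)))"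
  proof -
    have "linear_map A ground (\<lambda>j. sw j (\<lambda>a b. e i (x * S a * S (S c)) * f b))" for i c by (intro I)
    from expand[OF k_vspace_ground this] show ?thesis by simp
  qed
  also have "\<dots> = (\<Sum>i\<leftarrow>bs. sw i (\<lambda>p b. sw p (\<lambda>c a. e i (x * S a * S (S c)) * f b)))"
    by (subst sw_coassoc[OF k_vspace_ground]) (intro I, intro I, intro I, rule refl)
  also have "\<dots> = (\<Sum>i\<leftarrow>bs. sw i (\<lambda>p b. sw p (\<lambda>c a. e i (x * S (S c * a)) * f b)))"
    by (simp only: antipode_mult mult.assoc)
  also have "\<dots> = (\<Sum>i\<leftarrow>bs. e i (x * S 1) * f i)"
    by (subst sw_cancel_l[OF k_vspace_ground antipode_l]) (intro I, intro I, rule refl)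
  also have "\<dots> = f x"
    using expand[OF k_vspace_ground f] by (simp add: antipode_one)
  finally show ?thesis .
qed

text \<open>If all projections vanished, the decomposition would make every linear form zero,
  whereas \<epsilon>(1) = 1.\<close>

lemma nonzero_integral: "\<exists>f y. linear_map A ground f \<and> integral_of f y \<noteq> 0"
proof (rule ccontr)
  assume "\<not> ?thesis"
  then have "integral_of (e j) y = 0" for j y using lin_e by blast
  then have "\<epsilon> 1 = 0"
    using integral_of_recover[OF lin_counit, of 1] by (simp add: sw_list)
  then show False by simp
qed

section \<open>Injectivity of the antipode\<close>

lemma antipode_eq_0:
  assumes "S h = 0"
  shows "h = 0"
proof -
  interpret V: vector_space "hscale H" using k_vspaceD(1)[OF vs_A] by simp
  obtain f y where f: "linear_map A ground f" and nz: "integral_of f y \<noteq> 0"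
    using nonzero_integral by blast
  define l where "l = integral_of f"
  note l = lin_integral_of[OF f, folded l_def]
  note I = linE_intros linear_map_comp[OF l] vs_A
  have zero: "sw h (\<lambda>a b. hscale H (l (x * S a)) b) = 0" for x
  proof -
    have "hscale H (l (x * S a)) b = sw a (\<lambda>s t. sw x (\<lambda>x1 x2. hscale H (l (x2 * S s)) (x1 * (S t * b))))" for a b
    proof -
      \<comment> \<open>The unit is split off so that coinvariance of \<open>l\<close> can be
        applied at x S(a).\<close>
      have "hscale H (l (x * S a)) b = hscale H (l (x * S a)) 1 * b"
        using linear_mapD(3)[OF lin_mult_l, of 1 "l (x * S a)" b] by simp
      also have "\<dots> = sw (x * S a) (\<lambda>x1 x2. hscale H (l x2) x1) * b"
        unfolding l_def by (simp only: integral_of_coinvariant[OF f])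
      also have "\<dots> = sw (x * S a) (\<lambda>x1 x2. hscale H (l x2) x1 * b)"
        by (rule sw_hom[OF vs_A vs_A lin_mult_l]) simp
      also have "\<dots> = sw (x * S a) (\<lambda>x1 x2. hscale H (l x2) (x1 * b))"
        using linear_mapD(3)[OF lin_mult_l, of _ _ b] by simp
      also have "\<dots> = sw (S a) (\<lambda>u v. sw x (\<lambda>x1 x2. hscale H (l (x2 * v)) (x1 * (u * b))))"
        by (subst sw_mult[OF vs_A], intro I, intro I, subst sw_swap, simp only: mult.assoc)
      also have "\<dots> = sw a (\<lambda>s t. sw x (\<lambda>x1 x2. hscale H (l (x2 * S s)) (x1 * (S t * b))))"
        by (rule sw_antipode[OF vs_A]) (intro I)+
      finally show ?thesis .
    qed
    then have "sw h (\<lambda>a b. hscale H (l (x * S a)) b) =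
        sw h (\<lambda>a b. sw a (\<lambda>s t. sw x (\<lambda>x1 x2. hscale H (l (x2 * S s)) (x1 * (S t * b)))))" by (simp only:)
    also have "\<dots> = sw h (\<lambda>s r. sw r (\<lambda>t b. sw x (\<lambda>x1 x2. hscale H (l (x2 * S s)) (x1 * (S t * b)))))"
      by (rule sw_coassoc[OF vs_A]) (intro I)+
    also have "\<dots> = sw x (\<lambda>x1 x2. hscale H (l (x2 * S h)) (x1 * 1))"
      by (rule sw_cancel_r[OF vs_A antipode_l]) (intro I)+
    also have "\<dots> = 0"
    proof -
      have "l 0 = 0" using linear_mapD(3)[OF l, of 0 0] by simp
      then show ?thesis using assms by (simp add: sw_list)
    qed
    finally show ?thesis .
  qed
  \<comment> \<open>With 1 = S(1) the unit inside S can be replaced by a S(c), whose image is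
    S(S(c)) S(a).\<close>
  have "hscale H (l y) h = hscale H (l (y * S 1)) h" by (simp add: antipode_one)
  also have "\<dots> = sw h (\<lambda>p d. sw p (\<lambda>a c. hscale H (l (y * S (a * S c))) d))"
    by (rule sw_cancel_l[OF vs_A antipode_r, symmetric]) (intro I)+
  also have "\<dots> = sw h (\<lambda>a b. sw b (\<lambda>c d. hscale H (l (y * S (a * S c))) d))"
    by (rule sw_coassoc[OF vs_A]) (intro I)+
  \<comment> \<open>The fact \<open>zero\<close> concerns a fixed x, while S(S(c)) varies with the
    legs. After expansion over the basis the argument y j is fixed in each summand.\<close>
  also have "\<dots> = sw h (\<lambda>a b. \<Sum>j\<leftarrow>bs. sw b (\<lambda>c d. hscale H (e j (S (S c))) (hscale H (l (y * j * S a)) d)))"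
  proof -
    have "hscale H (l (y * S (a * S c))) d =
        (\<Sum>j\<leftarrow>bs. hscale H (e j (S (S c))) (hscale H (l (y * j * S a)) d))" for a c d
    proof -
      have "linear_map A A (\<lambda>j. hscale H (l (y * j * S a)) d)" by (intro I)
      from expand[OF vs_A this, of "S (S c)"] show ?thesis by (simp add: antipode_mult mult.assoc)
    qed
    then show ?thesis by (simp only: sw_sum_list)
  qed
  also have "\<dots> = (\<Sum>j\<leftarrow>bs. sw h (\<lambda>a b. sw b (\<lambda>c d. hscale H (e j (S (S c))) (hscale H (l (y * j * S a)) d))))"
    by (rule sw_sum_list)
  also have "\<dots> = 0"
  proof -
    have "sw h (\<lambda>a b. sw b (\<lambda>c d. hscale H (e j (S (S c))) (hscale H (l (y * j * S a)) d))) = 0" for j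
    proof -
      \<comment> \<open>\<open>T\<close> collects what is still done to the second leg. Being
        linear, it can be pulled out of the sum that vanishes by \<open>zero\<close>.\<close>
      define T where "T b = sw b (\<lambda>c d. hscale H (e j (S (S c))) d)" for b
      have T: "linear_map A A T" unfolding T_def by (intro I)
      have "sw b (\<lambda>c d. hscale H (e j (S (S c))) (hscale H k d)) = T (hscale H k b)" for k b
        using linear_mapD(3)[OF T, of b k]
          sw_hom[OF vs_A vs_A lin_hscale_r[OF linear_map_id, of k], of "\<lambda>c d. hscale H (e j (S (S c))) d" b]
        by (simp add: T_def hscale_hscale mult.commute)
      then have "sw h (\<lambda>a b. sw b (\<lambda>c d. hscale H (e j (S (S c))) (hscale H (l (y * j * S a)) d))) =
          sw h (\<lambda>a b. T (hscale H (l (y * j * S a)) b))" by simp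
      also have "\<dots> = T (sw h (\<lambda>a b. hscale H (l (y * j * S a)) b))"
        by (rule sw_hom[OF vs_A vs_A T, symmetric]) simp
      also have "\<dots> = 0"
        using linear_mapD(3)[OF T, of 0 0] by (simp add: zero)
      finally show ?thesis .
    qed
    then show ?thesis by simp
  qed
  finally show ?thesis using nz by (simp add: l_def)
qed

end

lemma bij_antipode: "bij S"
proof (rule dual_basis)
  fix bs e
  assume be: "\<And>b. linear_map A ground (e b)" "\<And>x. (\<Sum>b\<leftarrow>bs. hscale H (e b x) b) = x"
  interpret finite_dimensional_vector_space "hscale H" Basis by (rule fd)
  have "Vector_Spaces.linear (hscale H) (hscale H) S"
    by unfold_locales (use linear_mapD[OF lin_antipode] in simp_all)
  then interpret L: Vector_Spaces.linear "hscale H" "hscale H" S .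
  have "inj S"
  proof (rule injI)
    fix x y assume "S x = S y"
    then have "S (x - y) = 0" by (simp add: L.diff)
    from antipode_eq_0[OF be this] show "x = y" by simp
  qed
  then show "bij S"
    using linear_inj_imp_surj[OF L.linear_axioms] by (simp add: bij_def)
qed

section \<open>The inverse antipode\<close>

abbreviation "S' \<equiv> antipode_inv H"

text \<open>\<open>antipode_inv\<close> is built from a choice of preimages; bijectivity makes it a
  two-sided inverse.\<close>

lemma antipode_S' [simp]: "S (S' x) = x" and S'_antipode [simp]: "S' (S x) = x"
  using bij_antipode by (simp_all add: bij_is_surj surj_f_inv_f bij_is_inj)

lemma lin_S': "linear_map A A S'"
proof (rule linear_mapI)
  have inj: "inj S" using bij_antipode by (rule bij_is_inj)
  show "S' (x + y) = S' x + S' y" for x y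
    by (rule injD[OF inj]) (use linear_mapD(2)[OF lin_antipode] in simp)
  show "S' (scal A c x) = scal A c (S' x)" for c x
    by (rule injD[OF inj]) (use linear_mapD(3)[OF lin_antipode] in simp)
qed simp

text \<open>Applying the injective map S reverses the products and gives the antipode laws. Read in
  the opposite algebra, the two identities say that \<open>S'\<close> is its antipode.\<close>

lemma
  shows S'_r: "sw h (\<lambda>a b. b * S' a) = hscale H (\<epsilon> h) 1"
    and S'_l: "sw h (\<lambda>a b. S' b * a) = hscale H (\<epsilon> h) 1"
proof -
  have inj: "inj S" using bij_antipode by (rule bij_is_inj)
  have *: "S (hscale H c 1) = hscale H c 1" for c
    using linear_mapD(3)[OF lin_antipode, of 1 c] by (simp add: antipode_one)
  show "sw h (\<lambda>a b. b * S' a) = hscale H (\<epsilon> h) 1"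
    by (rule injD[OF inj]) (simp add: sw_hom[OF vs_A vs_A lin_antipode] * antipode_mult antipode_r)
  show "sw h (\<lambda>a b. S' b * a) = hscale H (\<epsilon> h) 1"
    by (rule injD[OF inj]) (simp add: sw_hom[OF vs_A vs_A lin_antipode] * antipode_mult antipode_l)
qed

section \<open>The Hopf algebra \<open>H \<otimes> H\<^sup>o\<^sup>p\<close> on pairs\<close>

text \<open>A pair \<open>(h, g)\<close> stands for the pure tensor \<open>h \<otimes> g\<close>, and linear maps on \<open>H \<otimes> H\<close> are
  maps on pairs that are bilinear in the two components.\<close>

definition klin :: "('k, 'u::ab_group_add, 'z) vspace_scheme \<Rightarrow> ('h \<times> 'h \<Rightarrow> 'u) \<Rightarrow> bool" where
  "klin U f \<longleftrightarrow> (\<forall>g. linear_map A U (\<lambda>h. f (h, g))) \<and> (\<forall>h. linear_map A U (\<lambda>g. f (h, g)))"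

text \<open>These are the substitutions that keep a function on pairs bilinear: they act linearly on
  each component. Multiplication in K by a fixed pair and \<open>kS\<close> are of this
  form.\<close>

definition kend :: "('h \<times> 'h \<Rightarrow> 'h \<times> 'h) \<Rightarrow> bool" where
  "kend m \<longleftrightarrow> (\<exists>u v. linear_map A A u \<and> linear_map A A v \<and> m = (\<lambda>k. (u (fst k), v (snd k))))"

definition kmul :: "'h \<times> 'h \<Rightarrow> 'h \<times> 'h \<Rightarrow> 'h \<times> 'h" where
  "kmul k k' = (fst k * fst k', snd k' * snd k)"

definition kS :: "'h \<times> 'h \<Rightarrow> 'h \<times> 'h" where
  "kS k = (S (fst k), S' (snd k))"

definition keps :: "'h \<times> 'h \<Rightarrow> 'k" where
  "keps k = \<epsilon> (fst k) * \<epsilon> (snd k)"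

abbreviation kone :: "'h \<times> 'h" where "kone \<equiv> (1, 1)"

text \<open>The opposite algebra has the same coproduct as H, so both components split in the same
  order.\<close>

definition ksw :: "'h \<times> 'h \<Rightarrow> ('h \<times> 'h \<Rightarrow> 'h \<times> 'h \<Rightarrow> 'u::ab_group_add) \<Rightarrow> 'u" where
  "ksw k F = sw (fst k) (\<lambda>h1 h2. sw (snd k) (\<lambda>g1 g2. F (h1, g1) (h2, g2)))"

lemma kmul_assoc: "kmul (kmul a b) c = kmul a (kmul b c)"
  and kmul_one [simp]: "kmul kone a = a" "kmul a kone = a"
  by (simp_all add: kmul_def mult.assoc)

lemma kend_id: "kend (\<lambda>k. k)"
  unfolding kend_def by (intro exI[of _ "\<lambda>x. x"]) (simp add: linear_map_id)

lemma kendI: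
  assumes "linear_map A A u" "linear_map A A v" "kend m"
  shows "kend (\<lambda>k. (u (fst (m k)), v (snd (m k))))"
proof -
  obtain u' v' where m: "linear_map A A u'" "linear_map A A v'" "m = (\<lambda>k. (u' (fst k), v' (snd k)))"
    using assms(3) unfolding kend_def by blast
  show ?thesis
    unfolding kend_def m(3) fst_conv snd_conv
    using linear_map_comp[OF assms(1) m(1)] linear_map_comp[OF assms(2) m(2)] by blast
qed

lemma kend_mul_l: "kend m \<Longrightarrow> kend (\<lambda>k. kmul (m k) c)"
  unfolding kmul_def by (rule kendI[OF lin_mult_l lin_mult_r])

lemma kend_mul_r: "kend m \<Longrightarrow> kend (\<lambda>k. kmul c (m k))"
  unfolding kmul_def by (rule kendI[OF lin_mult_r lin_mult_l])

lemma kend_S: "kend m \<Longrightarrow> kend (\<lambda>k. kS (m k))"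
  unfolding kS_def by (rule kendI[OF lin_antipode lin_S'])

lemma klinD: assumes "klin U f"
  shows "linear_map A U (\<lambda>h. f (h, g))" "linear_map A U (\<lambda>g. f (h, g))"
  using assms by (simp_all add: klin_def)

lemma klinI:
  assumes "\<And>g. linear_map A U (\<lambda>h. f (h, g))" "\<And>h. linear_map A U (\<lambda>g. f (h, g))"
  shows "klin U f"
  using assms by (simp add: klin_def)

lemma klin_kend:
  assumes "klin U f" "kend m"
  shows "klin U (\<lambda>k. f (m k))"
proof -
  obtain u v where m: "linear_map A A u" "linear_map A A v" "m = (\<lambda>k. (u (fst k), v (snd k)))"
    using assms(2) unfolding kend_def by blast
  show ?thesis
    unfolding m(3)
    using linear_map_comp[OF klinD(1)[OF assms(1)] m(1)] linear_map_comp[OF klinD(2)[OF assms(1)] m(2)]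
    by (simp add: klin_def)
qed

lemma klin_comp: "linear_map V U g \<Longrightarrow> klin V f \<Longrightarrow> klin U (\<lambda>k. g (f k))"
  unfolding klin_def by (simp add: linear_map_comp[of V U g])

section \<open>Sweedler calculus on pairs\<close>

lemma ksw_swap: "ksw k (\<lambda>a b. ksw l (\<lambda>c d. F a b c d)) = ksw l (\<lambda>c d. ksw k (\<lambda>a b. F a b c d))"
proof -
  have "ksw k (\<lambda>a b. ksw l (\<lambda>c d. F a b c d)) =
    sw (fst k) (\<lambda>h1 h2. sw (fst l) (\<lambda>u1 u2. sw (snd k) (\<lambda>g1 g2. sw (snd l) (\<lambda>v1 v2.
      F (h1, g1) (h2, g2) (u1, v1) (u2, v2)))))"
    unfolding ksw_def by (subst sw_swap[of "snd k" "fst l"]) (rule refl)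
  also have "\<dots> = sw (fst l) (\<lambda>u1 u2. sw (fst k) (\<lambda>h1 h2. sw (snd k) (\<lambda>g1 g2. sw (snd l) (\<lambda>v1 v2.
      F (h1, g1) (h2, g2) (u1, v1) (u2, v2)))))"
    by (rule sw_swap)
  also have "\<dots> = sw (fst l) (\<lambda>u1 u2. sw (fst k) (\<lambda>h1 h2. sw (snd l) (\<lambda>v1 v2. sw (snd k) (\<lambda>g1 g2.
      F (h1, g1) (h2, g2) (u1, v1) (u2, v2)))))"
    by (subst sw_swap[of "snd k" "snd l"]) (rule refl)
  also have "\<dots> = ksw l (\<lambda>c d. ksw k (\<lambda>a b. F a b c d))"
    unfolding ksw_def by (subst sw_swap[of "fst k" "snd l"]) (rule refl)
  finally show ?thesis .
qed

lemma ksw_mem: "k_vspace U \<Longrightarrow> (\<And>a b. F a b \<in> carr U) \<Longrightarrow> ksw k F \<in> carr U"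
  unfolding ksw_def by (intro sw_mem)

lemma ksw_hom:
  assumes "k_vspace U" "k_vspace W" "linear_map U W f" "\<And>a b. F a b \<in> carr U"
  shows "f (ksw k F) = ksw k (\<lambda>a b. f (F a b))"
  unfolding ksw_def by (simp add: sw_hom[OF assms(1-3)] sw_mem assms)

lemma lin_ksw_param:
  "k_vspace U \<Longrightarrow> (\<And>a b. linear_map X U (\<lambda>x. F x a b)) \<Longrightarrow> linear_map X U (\<lambda>x. ksw k (F x))"
  unfolding ksw_def by (intro lin_sw_param)

lemma klin_ksw_param:
  assumes "k_vspace U" "\<And>a b. klin U (\<lambda>x. F x a b)"
  shows "klin U (\<lambda>x. ksw k (F x))"
  by (intro klinI lin_ksw_param assms(1) klinD[OF assms(2)])

lemma klin_ksw:
  assumes U: "k_vspace U" and F: "\<And>b. klin U (\<lambda>a. F a b)" "\<And>a. klin U (F a)" and m: "kend m"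
  shows "klin U (\<lambda>k. ksw (m k) F)"
proof (rule klin_kend[OF _ m])
  show "klin U (\<lambda>k. ksw k F)"
    unfolding ksw_def fst_conv snd_conv
    by (intro klinI)
       (simp_all, (intro lin_sw lin_sw_param U linear_map_id klinD[OF F(1)] klinD[OF F(2)])+)
qed

lemma ksw_coassoc:
  assumes U: "k_vspace U"
    and F: "\<And>b c. klin U (\<lambda>a. F a b c)" "\<And>a c. klin U (\<lambda>b. F a b c)" "\<And>a b. klin U (\<lambda>c. F a b c)"
  shows "ksw k (\<lambda>a c. ksw a (\<lambda>x y. F x y c)) = ksw k (\<lambda>a c. ksw c (\<lambda>x y. F a x y))"
proof -
  note I = U lin_sw lin_sw_param linear_map_id klinD[OF F(1)] klinD[OF F(2)] klinD[OF F(3)]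
  have "ksw k (\<lambda>a c. ksw a (\<lambda>x y. F x y c)) =
      sw (fst k) (\<lambda>h1 h2. sw h1 (\<lambda>x1 x2. sw (snd k) (\<lambda>g1 g2. sw g1 (\<lambda>y1 y2. F (x1, y1) (x2, y2) (h2, g2)))))"
    unfolding ksw_def fst_conv snd_conv by (subst sw_swap[of "snd k"]) (rule refl)
  also have "\<dots> = sw (fst k) (\<lambda>x1 r. sw r (\<lambda>x2 h2. sw (snd k) (\<lambda>g1 g2. sw g1 (\<lambda>y1 y2. F (x1, y1) (x2, y2) (h2, g2)))))"
    by (rule sw_coassoc[OF U]) (intro I)+
  also have "\<dots> = sw (fst k) (\<lambda>x1 r. sw r (\<lambda>x2 h2. sw (snd k) (\<lambda>y1 s. sw s (\<lambda>y2 g2. F (x1, y1) (x2, y2) (h2, g2)))))"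
    by (subst sw_coassoc[OF U, of _ "snd k"]) (intro I, intro I, intro I, rule refl)
  also have "\<dots> = ksw k (\<lambda>a c. ksw c (\<lambda>x y. F a x y))"
    unfolding ksw_def fst_conv snd_conv by (subst sw_swap[of _ "snd k"]) (rule refl)
  finally show ?thesis .
qed

lemma ksw_mult:
  assumes U: "k_vspace U" and F: "\<And>b. klin U (\<lambda>a. F a b)" "\<And>a. klin U (F a)"
  shows "ksw (kmul k l) F = ksw k (\<lambda>a b. ksw l (\<lambda>c d. F (kmul a c) (kmul b d)))"
proof -
  note I = U lin_sw lin_sw_param linear_map_id klinD[OF F(1)] klinD[OF F(2)]
  have "ksw (kmul k l) F = sw (fst k) (\<lambda>h1 h2. sw (fst l) (\<lambda>u1 u2. sw (snd l * snd k) (\<lambda>g1 g2. F (h1 * u1, g1) (h2 * u2, g2))))"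
    unfolding ksw_def kmul_def fst_conv snd_conv
    by (rule sw_mult[OF U]) (intro I)+
  also have "\<dots> = sw (fst k) (\<lambda>h1 h2. sw (fst l) (\<lambda>u1 u2. sw (snd l) (\<lambda>v1 v2. sw (snd k) (\<lambda>g1 g2.
      F (h1 * u1, v1 * g1) (h2 * u2, v2 * g2)))))"
    by (subst sw_mult[OF U]) (intro I, intro I, rule refl)
  also have "\<dots> = sw (fst k) (\<lambda>h1 h2. sw (fst l) (\<lambda>u1 u2. sw (snd k) (\<lambda>g1 g2. sw (snd l) (\<lambda>v1 v2.
      F (h1 * u1, v1 * g1) (h2 * u2, v2 * g2)))))"
    by (subst sw_swap[of "snd l"]) (rule refl)
  also have "\<dots> = ksw k (\<lambda>a b. ksw l (\<lambda>c d. F (kmul a c) (kmul b d)))"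
    unfolding ksw_def kmul_def fst_conv snd_conv by (subst sw_swap[of "fst l"]) (rule refl)
  finally show ?thesis .
qed

lemma ksw_one:
  assumes U: "k_vspace U" and F: "\<And>b. klin U (\<lambda>a. F a b)" "\<And>a. klin U (F a)"
  shows "ksw kone F = F kone kone"
proof -
  note I = U lin_sw lin_sw_param linear_map_id klinD[OF F(1)] klinD[OF F(2)]
  have "ksw kone F = sw 1 (\<lambda>g1 g2. F (1, g1) (1, g2))"
    unfolding ksw_def fst_conv snd_conv by (rule sw_one[OF U]) (intro I)+
  also have "\<dots> = F kone kone"
    by (rule sw_one[OF U]) (intro I)+
  finally show ?thesis .
qed

lemma scal_mult: "k_vspace U \<Longrightarrow> scal U (a * b) x = scal U a (scal U b x)"
proof -
  assume "k_vspace U"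
  then interpret vector_space "scal U" by (rule k_vspaceD)
  show ?thesis by simp
qed

lemma lin_scal: "k_vspace U \<Longrightarrow> linear_map U U (scal U c)"
proof -
  assume U: "k_vspace U"
  then interpret vector_space "scal U" by (rule k_vspaceD)
  show ?thesis
    by (rule linear_mapI) (use k_vspaceD[OF U] in \<open>auto simp: scale_right_distrib mult.commute\<close>)
qed

lemma ksw_counit_l:
  assumes U: "k_vspace U" and f: "klin U f"
  shows "ksw k (\<lambda>a b. scal U (keps a) (f b)) = f k"
proof -
  have "ksw k (\<lambda>a b. scal U (keps a) (f b)) =
      sw (fst k) (\<lambda>h1 h2. sw (snd k) (\<lambda>g1 g2. scal U (\<epsilon> g1) (scal U (\<epsilon> h1) (f (h2, g2)))))"
    by (simp add: ksw_def keps_def mult.commute flip: scal_mult[OF U])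
  also have "\<dots> = sw (fst k) (\<lambda>h1 h2. scal U (\<epsilon> h1) (f (h2, snd k)))"
    using sw_counit_l[OF U linear_map_comp[OF lin_scal[OF U] klinD(2)[OF f]]] by simp
  also have "\<dots> = f (fst k, snd k)"
    by (rule sw_counit_l[OF U klinD(1)[OF f]])
  finally show ?thesis by simp
qed

lemma ksw_counit_r:
  assumes U: "k_vspace U" and f: "klin U f"
  shows "ksw k (\<lambda>a b. scal U (keps b) (f a)) = f k"
proof -
  have "ksw k (\<lambda>a b. scal U (keps b) (f a)) =
      sw (fst k) (\<lambda>h1 h2. sw (snd k) (\<lambda>g1 g2. scal U (\<epsilon> g2) (scal U (\<epsilon> h2) (f (h1, g1)))))"
    by (simp add: ksw_def keps_def mult.commute flip: scal_mult[OF U])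
  also have "\<dots> = sw (fst k) (\<lambda>h1 h2. scal U (\<epsilon> h2) (f (h1, snd k)))"
    using sw_counit_r[OF U linear_map_comp[OF lin_scal[OF U] klinD(2)[OF f]]] by simp
  also have "\<dots> = f (fst k, snd k)"
    by (rule sw_counit_r[OF U klinD(1)[OF f]])
  finally show ?thesis by simp
qed

text \<open>Second components multiply in reverse, so each law for S in the first component is
  paired with the law for \<open>S'\<close> in which the two factors stand in the other
  order.\<close>

lemma ksw_antipode:
  assumes U: "k_vspace U" and f: "klin U f"
  shows "ksw k (\<lambda>a b. f (kmul (kS a) b)) = scal U (keps k) (f kone)"
    and "ksw k (\<lambda>a b. f (kmul a (kS b))) = scal U (keps k) (f kone)"
proof -
  have *: "sw (fst k) (\<lambda>h1 h2. sw (snd k) (\<lambda>g1 g2. f (P h1 h2, Q g1 g2))) = scal U (keps k) (f kone)"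
    if P: "\<And>h. sw h P = hscale H (\<epsilon> h) 1" and Q: "\<And>h. sw h Q = hscale H (\<epsilon> h) 1" for P Q
  proof -
    have "sw (snd k) (\<lambda>g1 g2. f (h, Q g1 g2)) = scal U (\<epsilon> (snd k)) (f (h, 1))" for h
      using sw_hom[OF vs_A U klinD(2)[OF f, of h], of Q "snd k"] linear_mapD(3)[OF klinD(2)[OF f, of h], of 1]
      by (simp add: Q)
    moreover have "sw (fst k) (\<lambda>h1 h2. scal U c (f (P h1 h2, 1))) = scal U (c * \<epsilon> (fst k)) (f kone)" for c
    proof -
      have "linear_map A U (\<lambda>h. scal U c (f (h, 1)))"
        by (rule linear_map_comp[OF lin_scal[OF U] klinD(1)[OF f]])
      from sw_hom[OF vs_A U this, of P "fst k"] show ?thesis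
        using linear_mapD(3)[OF klinD(1)[OF f, of 1], of 1 "\<epsilon> (fst k)"]
        by (simp add: P scal_mult[OF U])
    qed
    ultimately show ?thesis by (simp add: keps_def mult.commute)
  qed
  show "ksw k (\<lambda>a b. f (kmul (kS a) b)) = scal U (keps k) (f kone)"
    using *[OF antipode_l S'_r] by (simp add: ksw_def kmul_def kS_def)
  show "ksw k (\<lambda>a b. f (kmul a (kS b))) = scal U (keps k) (f kone)"
    using *[OF antipode_r S'_l] by (simp add: ksw_def kmul_def kS_def)
qed

lemma ksw_cancel:
  assumes U: "k_vspace U" and G: "\<And>b. klin U (\<lambda>a. G a b)" "\<And>a. klin U (G a)"
  shows "ksw k (\<lambda>a b. ksw b (\<lambda>c d. G a (kmul (kS c) d))) = G k kone"
    and "ksw k (\<lambda>a b. ksw b (\<lambda>c d. G a (kmul c (kS d)))) = G k kone"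
  by (simp_all add: ksw_antipode[OF U G(2)] ksw_counit_r[OF U G(1)])

section \<open>The dual algebra as a module algebra\<close>

abbreviation "D \<equiv> dual_alg H"
abbreviation "mu \<equiv> amult D"

lemma carr_D: "p \<in> carr D \<longleftrightarrow> linear_map A ground p"
  and scal_D [simp]: "scal D = fscale"
  and aone_D [simp]: "aone D = \<epsilon>"
  and mu_apply: "mu p q x = sw x (\<lambda>a b. p a * q b)"
  by (simp_all add: dual_alg_def)

lemma vs_D: "k_vspace D"
proof -
  interpret F: vector_space "fscale :: 'k \<Rightarrow> ('h \<Rightarrow> 'k) \<Rightarrow> 'h \<Rightarrow> 'k" by (rule vector_space_fscale)
  have "F.subspace (carr D)"
    by (rule F.subspaceI) (simp_all add: carr_D linear_map_def fscale_def algebra_simps)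
  then show ?thesis
    by (simp add: k_vspace_def F.vector_space_axioms)
qed

lemma counit_mem: "\<epsilon> \<in> carr D"
  unfolding carr_D by (rule lin_counit)

lemma mu_mem:
  assumes "p \<in> carr D" "q \<in> carr D"
  shows "mu p q \<in> carr D"
  unfolding carr_D mu_apply[abs_def]
  by (intro linS_intros assms[unfolded carr_D, THEN linear_map_comp])

lemma lin_mu_l:
  assumes "q \<in> carr D"
  shows "linear_map D D (\<lambda>p. mu p q)"
proof (rule linear_mapI)
  show "mu p q \<in> carr D" if "p \<in> carr D" for p using mu_mem that assms .
  show "mu (p + p') q = mu p q + mu p' q" for p p'
    by (rule ext) (simp add: mu_apply sw_list distrib_right sum_list_addf)
  show "mu (scal D c p) q = scal D c (mu p q)" for c p
    by (rule ext) (simp only: scal_D mu_apply sw_list fscale_def mult.assoc sum_list_const_mult)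
qed

lemma lin_mu_r:
  assumes "p \<in> carr D"
  shows "linear_map D D (\<lambda>q. mu p q)"
proof (rule linear_mapI)
  show "mu p q \<in> carr D" if "q \<in> carr D" for q using mu_mem assms that .
  show "mu p (q + q') = mu p q + mu p q'" for q q'
    by (rule ext) (simp add: mu_apply sw_list distrib_left sum_list_addf)
  show "mu p (scal D c q) = scal D c (mu p q)" for c q
    by (rule ext) (simp only: scal_D mu_apply sw_list fscale_def mult.left_commute[of _ c] sum_list_const_mult)
qed

lemma mu_assoc:
  assumes "p \<in> carr D" "q \<in> carr D" "r \<in> carr D"
  shows "mu (mu p q) r = mu p (mu q r)"
proof
  fix x
  note I = linS_intros assms[unfolded carr_D, THEN linear_map_comp]
  have "mu (mu p q) r x = sw x (\<lambda>a c. sw a (\<lambda>u v. p u * q v * r c))"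
    by (simp add: mu_apply sw_list sum_list_mult_const)
  also have "\<dots> = sw x (\<lambda>a c. sw c (\<lambda>u v. p a * q u * r v))"
    by (rule sw_coassoc[OF k_vspace_ground]) (intro I)+
  also have "\<dots> = mu p (mu q r) x"
    by (simp add: mu_apply sw_list sum_list_const_mult mult.assoc)
  finally show "mu (mu p q) r x = mu p (mu q r) x" .
qed

lemma mu_counit_l: "p \<in> carr D \<Longrightarrow> mu \<epsilon> p = p"
  and mu_counit_r: "p \<in> carr D \<Longrightarrow> mu p \<epsilon> = p"
  using sw_counit_l[OF k_vspace_ground, of p] sw_counit_r[OF k_vspace_ground, of p]
  by (simp_all add: carr_D fun_eq_iff mu_apply mult.commute)

section \<open>The two-sided regular action\<close>

definition act :: "'h \<times> 'h \<Rightarrow> ('h \<Rightarrow> 'k) \<Rightarrow> 'h \<Rightarrow> 'k" where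
  "act k p = fst k \<rightharpoonup> p \<leftharpoonup> snd k"

lemma act_apply: "act k p x = p (snd k * (x * fst k))"
  by (simp add: act_def lact_def ract_def)

lemma act_mem:
  assumes "p \<in> carr D"
  shows "act k p \<in> carr D"
  unfolding carr_D act_apply[abs_def] by (intro linS_intros assms[unfolded carr_D, THEN linear_map_comp])

lemma lin_act: "linear_map D D (act k)"
  by (rule linear_mapI) (auto simp: act_mem fun_eq_iff act_apply fscale_def)

lemma klin_act:
  assumes "p \<in> carr D" "kend m"
  shows "klin D (\<lambda>k. act (m k) p)"
proof (rule klin_kend[OF _ assms(2)])
  have "linear_map A ground p" using assms by (simp add: carr_D)
  note p = linear_mapD[OF this, simplified]
  have d: "(a + b) * c = a * c + b * c" "c * (a + b) = c * a + c * b" for a b c :: 'h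
    by (simp_all add: algebra_simps)
  have s: "hscale H c a * b = hscale H c (a * b)" "a * hscale H c b = hscale H c (a * b)" for c a b
    using linear_mapD(3)[OF lin_mult_l, of a c b] linear_mapD(3)[OF lin_mult_r, of b a c] by simp_all
  show "klin D (\<lambda>k. act k p)"
    by (intro klinI linear_mapI)
       (simp_all add: act_mem assms fun_eq_iff act_apply fscale_def p s d)
qed

lemma act_mul: "act (kmul k l) p = act k (act l p)"
  by (simp add: fun_eq_iff act_apply kmul_def mult.assoc)

lemma act_one [simp]: "act kone p = p"
  by (simp add: fun_eq_iff act_apply)

lemma act_counit: "act k \<epsilon> = fscale (keps k) \<epsilon>"
  by (simp add: fun_eq_iff act_apply fscale_def keps_def counit_mult)

text \<open>The left side evaluates p and q on the coproduct of g x h, which splits factor by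
  factor. The two legs of x recombine into the product of \<open>act a p\<close> and
  \<open>act b q\<close>.\<close>

lemma act_mu:
  assumes "p \<in> carr D" "q \<in> carr D"
  shows "act k (mu p q) = ksw k (\<lambda>a b. mu (act a p) (act b q))"
proof
  fix x
  note I = linS_intros assms[unfolded carr_D, THEN linear_map_comp]
  obtain h g where k: "k = (h, g)" by fastforce
  have "act k (mu p q) x = sw (g * (x * h)) (\<lambda>a b. p a * q b)"
    by (simp add: act_apply mu_apply k)
  also have "\<dots> = sw g (\<lambda>g1 g2. sw (x * h) (\<lambda>a b. p (g1 * a) * q (g2 * b)))"
    by (rule sw_mult[OF k_vspace_ground]) (intro I)+
  also have "\<dots> = sw g (\<lambda>g1 g2. sw x (\<lambda>x1 x2. sw h (\<lambda>h1 h2. p (g1 * (x1 * h1)) * q (g2 * (x2 * h2)))))"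
    by (subst sw_mult[OF k_vspace_ground]) (intro I, intro I, rule refl)
  also have "\<dots> = sw g (\<lambda>g1 g2. sw h (\<lambda>h1 h2. sw x (\<lambda>x1 x2. p (g1 * (x1 * h1)) * q (g2 * (x2 * h2)))))"
    by (subst sw_swap[of x h]) (rule refl)
  also have "\<dots> = sw h (\<lambda>h1 h2. sw g (\<lambda>g1 g2. sw x (\<lambda>x1 x2. p (g1 * (x1 * h1)) * q (g2 * (x2 * h2)))))"
    by (rule sw_swap)
  also have "\<dots> = ksw k (\<lambda>a b. mu (act a p) (act b q)) x"
    by (simp add: k ksw_def sw_apply mu_apply act_apply)
  finally show "act k (mu p q) x = ksw k (\<lambda>a b. mu (act a p) (act b q)) x" .
qed

section \<open>Multilinear maps on the two underlying spaces\<close>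

abbreviation "Z \<equiv> z_space H"
abbreviation "Y \<equiv> y_space H"

definition zel :: "('h \<Rightarrow> 'k) \<Rightarrow> ('h \<Rightarrow> 'k) \<Rightarrow> 'h \<times> 'h \<Rightarrow> ('k, 'h) ztensor" where
  "zel p q k = z_elem H p q (fst k) (snd k)"

text \<open>The pair comes last, unlike in \<open>y_elem\<close>, so that one notion of multilinear
  map serves both spaces.\<close>

definition yel :: "('h \<Rightarrow> 'k) \<Rightarrow> ('h \<Rightarrow> 'k) \<Rightarrow> 'h \<times> 'h \<Rightarrow> ('k, 'h) ytensor" where
  "yel p q k = y_elem H p (fst k) (snd k) q"

definition zlift :: "(('h \<Rightarrow> 'k) \<Rightarrow> ('h \<Rightarrow> 'k) \<Rightarrow> 'h \<times> 'h \<Rightarrow> 'u::ab_group_add) \<Rightarrow> ('k, 'h) ztensor \<Rightarrow> 'u" where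
  "zlift F = z_lift H (\<lambda>p q h g. F p q (h, g))"

definition ylift :: "(('h \<Rightarrow> 'k) \<Rightarrow> ('h \<Rightarrow> 'k) \<Rightarrow> 'h \<times> 'h \<Rightarrow> 'u::ab_group_add) \<Rightarrow> ('k, 'h) ytensor \<Rightarrow> 'u" where
  "ylift F = y_lift H (\<lambda>p h g q. F p q (h, g))"

definition multilin :: "('k, 'u::ab_group_add, 'z) vspace_scheme \<Rightarrow>
    (('h \<Rightarrow> 'k) \<Rightarrow> ('h \<Rightarrow> 'k) \<Rightarrow> 'h \<times> 'h \<Rightarrow> 'u) \<Rightarrow> bool" where
  "multilin U F \<longleftrightarrow>
     (\<forall>q\<in>carr D. \<forall>k. linear_map D U (\<lambda>p. F p q k)) \<and>
     (\<forall>p\<in>carr D. \<forall>k. linear_map D U (\<lambda>q. F p q k)) \<and>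
     (\<forall>p\<in>carr D. \<forall>q\<in>carr D. klin U (F p q))"

lemma multilinI:
  assumes "\<And>q k. q \<in> carr D \<Longrightarrow> linear_map D U (\<lambda>p. F p q k)"
    and "\<And>p k. p \<in> carr D \<Longrightarrow> linear_map D U (\<lambda>q. F p q k)"
    and "\<And>p q. p \<in> carr D \<Longrightarrow> q \<in> carr D \<Longrightarrow> klin U (\<lambda>k. F p q k)"
  shows "multilin U F"
  using assms by (simp add: multilin_def)

lemma multilinD:
  assumes "multilin U F"
  shows "q \<in> carr D \<Longrightarrow> linear_map D U (\<lambda>p. F p q k)"
    and "p \<in> carr D \<Longrightarrow> linear_map D U (\<lambda>q. F p q k)"
    and "p \<in> carr D \<Longrightarrow> q \<in> carr D \<Longrightarrow> klin U (F p q)"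
  using assms by (simp_all add: multilin_def del: split_paired_All)

lemma vs_Z: "k_vspace Z" and vs_Y: "k_vspace Y"
  by (simp_all add: z_space_def y_space_def k_vspace_tensor)

lemma lin_pure_l: "w \<in> carr W \<Longrightarrow> linear_map V (tensor V W) (\<lambda>v. pure_tensor V W v w)"
  and lin_pure_r: "v \<in> carr V \<Longrightarrow> linear_map W (tensor V W) (\<lambda>w. pure_tensor V W v w)"
  by (rule bilinear_map_lin[OF bilinear_map_pure_tensor]; assumption)+

lemma pure_AA_mem: "pure_tensor A A h g \<in> carr AA"
  by (simp add: pure_tensor_mem)

lemma klin_pure: "klin AA (\<lambda>k. pure_tensor A A (fst k) (snd k))"
  by (rule klinI) (simp_all add: lin_pure_l lin_pure_r)

lemma zel_pure: "zel p q k = pure_tensor (tensor D D) AA (pure_tensor D D p q) (pure_tensor A A (fst k) (snd k))"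
  by (simp add: zel_def z_elem_def Let_def)

lemma yel_pure: "yel p q k = pure_tensor D (tensor AA D) p (pure_tensor AA D (pure_tensor A A (fst k) (snd k)) q)"
  by (simp add: yel_def y_elem_def Let_def)

lemma multilin_zel: "multilin Z zel"
  unfolding z_space_def zel_pure[abs_def]
  by (rule multilinI)
     (rule linear_map_comp[OF lin_pure_l] linear_map_comp[OF lin_pure_r] klin_comp[OF lin_pure_r]
        lin_pure_l lin_pure_r klin_pure pure_AA_mem pure_tensor_mem | assumption)+

lemma multilin_yel: "multilin Y yel"
  unfolding y_space_def yel_pure[abs_def]
  by (rule multilinI)
     (rule lin_pure_l linear_map_comp[OF lin_pure_r] klin_comp[OF lin_pure_r] klin_comp[OF lin_pure_l]
        lin_pure_r klin_pure pure_AA_mem pure_tensor_mem | assumption)+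

lemma zel_mem: "p \<in> carr D \<Longrightarrow> q \<in> carr D \<Longrightarrow> zel p q k \<in> carr Z"
  using linear_mapD(1)[OF multilinD(1)[OF multilin_zel]] .

lemma yel_mem: "p \<in> carr D \<Longrightarrow> q \<in> carr D \<Longrightarrow> yel p q k \<in> carr Y"
  using linear_mapD(1)[OF multilinD(1)[OF multilin_yel]] .

lemma klin_bilinear: "klin U (\<lambda>k. F (fst k) (snd k)) \<Longrightarrow> bilinear_map A A U F"
  by (rule bilinear_mapI) (simp_all add: klin_def)

section \<open>Extension of multilinear maps to the tensor spaces\<close>

context
  fixes U :: "('k, 'u::ab_group_add, 'z) vspace_scheme"
    and F :: "('h \<Rightarrow> 'k) \<Rightarrow> ('h \<Rightarrow> 'k) \<Rightarrow> 'h \<times> 'h \<Rightarrow> 'u"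
  assumes U: "k_vspace U" and F: "multilin U F"
begin

lemma bil_AA:
  assumes "p \<in> carr D" "q \<in> carr D"
  shows "bilinear_map A A U (\<lambda>h g. F p q (h, g))"
  by (rule klin_bilinear) (use multilinD(3)[OF F assms] in simp)

lemma lift_param:
  assumes "t \<in> carr AA"
  shows "q \<in> carr D \<Longrightarrow> linear_map D U (\<lambda>p. tensor_lift A A (\<lambda>h g. F p q (h, g)) t)"
    and "p \<in> carr D \<Longrightarrow> linear_map D U (\<lambda>q. tensor_lift A A (\<lambda>h g. F p q (h, g)) t)"
  by (rule linear_map_tensor_lift_param[OF vs_A U assms], rule multilinD[OF F], assumption)+

lemma bil_DD:
  assumes "t \<in> carr AA"
  shows "bilinear_map D D U (\<lambda>p q. tensor_lift A A (\<lambda>h g. F p q (h, g)) t)"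
  using lift_param[OF assms] by (rule bilinear_mapI)

lemma bil_AD:
  assumes "p \<in> carr D"
  shows "bilinear_map AA D U (\<lambda>t q. tensor_lift A A (\<lambda>h g. F p q (h, g)) t)"
proof (rule bilinear_mapI)
  show "linear_map AA U (tensor_lift A A (\<lambda>h g. F p q (h, g)))" if "q \<in> carr D" for q
    by (rule linear_map_tensor_lift[OF vs_A U bil_AA[OF assms that]])
  show "linear_map D U (\<lambda>q. tensor_lift A A (\<lambda>h g. F p q (h, g)) t)" if "t \<in> carr AA" for t
    by (rule lift_param(2)[OF that assms])
qed

lemma bil_z:
  "bilinear_map (tensor D D) AA U (\<lambda>s t. tensor_lift D D (\<lambda>p q. tensor_lift A A (\<lambda>h g. F p q (h, g)) t) s)"
  by (intro bilinear_mapI linear_map_tensor_lift vs_D U bil_DD linear_map_tensor_lift_param vs_A bil_AA)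

lemma bil_y:
  "bilinear_map D (tensor AA D) U (\<lambda>p. tensor_lift AA D (\<lambda>t q. tensor_lift A A (\<lambda>h g. F p q (h, g)) t))"
  by (intro bilinear_mapI linear_map_tensor_lift vs_AA U bil_AD linear_map_tensor_lift_param lift_param)

lemma zlift_zel:
  assumes "p \<in> carr D" "q \<in> carr D"
  shows "zlift F (zel p q k) = F p q k"
  using assms
  by (simp add: zlift_def z_lift_def Let_def zel_pure tensor_lift_pure[OF U bil_z] pure_tensor_mem
      tensor_lift_pure[OF U bil_DD] tensor_lift_pure[OF U bil_AA])

lemma ylift_yel:
  assumes "p \<in> carr D" "q \<in> carr D"
  shows "ylift F (yel p q k) = F p q k"
  using assms
  by (simp add: ylift_def y_lift_def Let_def yel_pure tensor_lift_pure[OF U bil_y] pure_tensor_mem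
      tensor_lift_pure[OF U bil_AD] tensor_lift_pure[OF U bil_AA])

lemma lin_zlift: "linear_map Z U (zlift F)"
  unfolding z_space_def zlift_def z_lift_def Let_def
  by (rule linear_map_tensor_lift[OF k_vspace_tensor U bil_z])

lemma lin_ylift: "linear_map Y U (ylift F)"
  unfolding y_space_def ylift_def y_lift_def Let_def
  by (rule linear_map_tensor_lift[OF vs_D U bil_y])

end

lemma lin_zlift_param:
  assumes "k_vspace U" "z \<in> carr Z"
    and "\<And>p q k. p \<in> carr D \<Longrightarrow> q \<in> carr D \<Longrightarrow> linear_map X U (\<lambda>x. F x p q k)"
  shows "linear_map X U (\<lambda>x. zlift (F x) z)"
  using assms(2) unfolding z_space_def zlift_def z_lift_def Let_def
  by (intro linear_map_tensor_lift_param assms k_vspace_tensor vs_D vs_A)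

lemma lin_ylift_param:
  assumes "k_vspace U" "y \<in> carr Y"
    and "\<And>p q k. p \<in> carr D \<Longrightarrow> q \<in> carr D \<Longrightarrow> linear_map X U (\<lambda>x. F x p q k)"
  shows "linear_map X U (\<lambda>x. ylift (F x) y)"
  using assms(2) unfolding y_space_def ylift_def y_lift_def Let_def
  by (intro linear_map_tensor_lift_param assms k_vspace_tensor vs_D vs_A)

lemma klin_zlift_param:
  assumes "k_vspace U" "z \<in> carr Z"
    and "\<And>p q k. p \<in> carr D \<Longrightarrow> q \<in> carr D \<Longrightarrow> klin U (\<lambda>x. F x p q k)"
  shows "klin U (\<lambda>x. zlift (F x) z)"
  by (rule klinI; rule lin_zlift_param[OF assms(1,2)]; rule klinD[OF assms(3)])

lemma klin_ylift_param:
  assumes "k_vspace U" "y \<in> carr Y"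
    and "\<And>p q k. p \<in> carr D \<Longrightarrow> q \<in> carr D \<Longrightarrow> klin U (\<lambda>x. F x p q k)"
  shows "klin U (\<lambda>x. ylift (F x) y)"
  by (rule klinI; rule lin_ylift_param[OF assms(1,2)]; rule klinD[OF assms(3)])

section \<open>Linear maps are determined on generators\<close>

lemma AA_eqI:
  assumes "k_vspace U" "linear_map AA U f" "linear_map AA U g"
    and "\<And>k. f (pure_tensor A A (fst k) (snd k)) = g (pure_tensor A A (fst k) (snd k))"
    and "t \<in> carr AA"
  shows "f t = g t"
  by (rule tensor_linear_eqI[OF vs_A assms(1-3) _ assms(5)]) (use assms(4)[of "(_, _)"] in simp)

lemma z_eqI:
  assumes U: "k_vspace U" and f: "linear_map Z U f" and g: "linear_map Z U g"
    and eq: "\<And>p q k. p \<in> carr D \<Longrightarrow> q \<in> carr D \<Longrightarrow> f (zel p q k) = g (zel p q k)"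
    and z: "z \<in> carr Z"
  shows "f z = g z"
proof (rule tensor_linear_eqI[OF k_vspace_tensor U f[unfolded z_space_def] g[unfolded z_space_def] _
      z[unfolded z_space_def]])
  let ?P = "pure_tensor (tensor D D) AA"
  note f' = f[unfolded z_space_def] and g' = g[unfolded z_space_def]
  fix s t assume s: "s \<in> carr (tensor D D)" and t: "t \<in> carr AA"
  show "f (?P s t) = g (?P s t)"
  proof (rule tensor_linear_eqI[OF vs_D U linear_map_comp[OF f' lin_pure_l[OF t]]
        linear_map_comp[OF g' lin_pure_l[OF t]] _ s])
    fix p q assume pq: "p \<in> carr D" "q \<in> carr D"
    note m = pure_tensor_mem[OF pq]
    show "f (?P (pure_tensor D D p q) t) = g (?P (pure_tensor D D p q) t)"
      by (rule AA_eqI[OF U linear_map_comp[OF f' lin_pure_r[OF m]] linear_map_comp[OF g' lin_pure_r[OF m]] _ t])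
         (use eq[OF pq] in \<open>simp add: zel_pure\<close>)
  qed
qed

lemma y_eqI:
  assumes U: "k_vspace U" and f: "linear_map Y U f" and g: "linear_map Y U g"
    and eq: "\<And>p q k. p \<in> carr D \<Longrightarrow> q \<in> carr D \<Longrightarrow> f (yel p q k) = g (yel p q k)"
    and y: "y \<in> carr Y"
  shows "f y = g y"
proof (rule tensor_linear_eqI[OF vs_D U f[unfolded y_space_def] g[unfolded y_space_def] _
      y[unfolded y_space_def]])
  let ?P = "pure_tensor D (tensor AA D)"
  note f' = f[unfolded y_space_def] and g' = g[unfolded y_space_def]
  fix p s assume p: "p \<in> carr D" and s: "s \<in> carr (tensor AA D)"
  show "f (?P p s) = g (?P p s)"
  proof (rule tensor_linear_eqI[OF vs_AA U linear_map_comp[OF f' lin_pure_r[OF p]]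
        linear_map_comp[OF g' lin_pure_r[OF p]] _ s])
    fix t q assume t: "t \<in> carr AA" and q: "q \<in> carr D"
    note m = linear_map_comp[OF lin_pure_r[OF p] lin_pure_l[OF q]]
    show "f (?P p (pure_tensor AA D t q)) = g (?P p (pure_tensor AA D t q))"
      by (rule AA_eqI[OF U linear_map_comp[OF f' m] linear_map_comp[OF g' m] _ t])
         (use eq[OF p q] in \<open>simp add: yel_pure\<close>)
  qed
qed

section \<open>The two products on generators\<close>

definition ksw3 :: "'h \<times> 'h \<Rightarrow> ('h \<times> 'h \<Rightarrow> 'h \<times> 'h \<Rightarrow> 'h \<times> 'h \<Rightarrow> 'u::ab_group_add) \<Rightarrow> 'u" where
  "ksw3 k F = ksw k (\<lambda>m c. ksw m (\<lambda>a b. F a b c))"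

text \<open>\<open>zprod\<close> and \<open>yprod\<close> are kept as functions of all six entries,
  so that linearity in each entry can be established before the formulas are lifted to
  tensors.\<close>

definition zprod where
  "zprod p q k p' q' k' =
     ksw3 k (\<lambda>k1 k2 k3. zel (mu p (act k1 p')) (mu (act k3 q') q) (kmul k2 k'))"

definition yprod where
  "yprod p q k p' q' k' =
     ksw k (\<lambda>k1 k2. ksw k' (\<lambda>l1 l2. yel (mu p (act k1 p')) (mu q' (act (kS l2) q)) (kmul k2 l1)))"

lemma z_mult_lift: "z_mult H x x' = zlift (\<lambda>p q k. zlift (zprod p q k) x') x"
proof -
  have "zprod p q (h, g) p' q' (h', g') =
      sweedler3 H h (\<lambda>h1 h2 h3. sweedler3 H g (\<lambda>g1 g2 g3.
          z_elem H (mu p (h1 \<rightharpoonup> p' \<leftharpoonup> g1)) (mu (h3 \<rightharpoonup> q' \<leftharpoonup> g3) q) (h2 * h') (g' * g2)))"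
    for p q h g p' q' h' g'
    unfolding zprod_def ksw3_def ksw_def sweedler3_def zel_def act_def kmul_def fst_conv snd_conv
    \<comment> \<open>\<open>ksw3\<close> splits both components before splitting their first legs,
      whereas \<open>sweedler3\<close> finishes with h before turning to g. Only the order of
      summation differs.\<close>
    by (subst sw_swap[of _ g]) (rule refl)
  then show ?thesis by (simp add: z_mult_def Let_def zlift_def)
qed

lemma y_mult_lift: "y_mult H x x' = ylift (\<lambda>p q k. ylift (yprod p q k) x') x"
  by (simp add: y_mult_def Let_def ylift_def yprod_def ksw_def yel_def act_def kmul_def kS_def)

lemmas mem_intros = act_mem mu_mem zel_mem yel_mem ksw_mem vs_Z vs_Y vs_D

text \<open>The outermost operation around the variable selects the rule. A variable functional is
  peeled out of linear maps; a variable pair is traced down to a substitution satisfying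
  \<open>kend\<close>.\<close>

lemmas lin_intros = mem_intros linear_map_id
  linear_map_comp[OF lin_act] linear_map_comp[OF lin_mu_l] linear_map_comp[OF lin_mu_r]
  linear_map_comp[OF multilinD(1)[OF multilin_zel]] linear_map_comp[OF multilinD(2)[OF multilin_zel]]
  linear_map_comp[OF multilinD(1)[OF multilin_yel]] linear_map_comp[OF multilinD(2)[OF multilin_yel]]
  lin_ksw_param
  kend_id kend_mul_l kend_mul_r kend_S
  klin_act klin_comp[OF lin_act] klin_comp[OF lin_mu_l] klin_comp[OF lin_mu_r]
  klin_comp[OF multilinD(1)[OF multilin_zel]] klin_comp[OF multilinD(2)[OF multilin_zel]]
  klin_comp[OF multilinD(1)[OF multilin_yel]] klin_comp[OF multilinD(2)[OF multilin_yel]]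
  klin_kend[OF multilinD(3)[OF multilin_zel]] klin_kend[OF multilinD(3)[OF multilin_yel]]
  klin_ksw_param klin_ksw

lemma zprod_lin:
  "q \<in> carr D \<Longrightarrow> p' \<in> carr D \<Longrightarrow> q' \<in> carr D \<Longrightarrow> linear_map D Z (\<lambda>p. zprod p q k p' q' k')"
  "p \<in> carr D \<Longrightarrow> p' \<in> carr D \<Longrightarrow> q' \<in> carr D \<Longrightarrow> linear_map D Z (\<lambda>q. zprod p q k p' q' k')"
  "p \<in> carr D \<Longrightarrow> q \<in> carr D \<Longrightarrow> p' \<in> carr D \<Longrightarrow> q' \<in> carr D \<Longrightarrow> klin Z (\<lambda>k. zprod p q k p' q' k')"
  "p \<in> carr D \<Longrightarrow> q \<in> carr D \<Longrightarrow> q' \<in> carr D \<Longrightarrow> linear_map D Z (\<lambda>p'. zprod p q k p' q' k')"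
  "p \<in> carr D \<Longrightarrow> q \<in> carr D \<Longrightarrow> p' \<in> carr D \<Longrightarrow> linear_map D Z (\<lambda>q'. zprod p q k p' q' k')"
  "p \<in> carr D \<Longrightarrow> q \<in> carr D \<Longrightarrow> p' \<in> carr D \<Longrightarrow> q' \<in> carr D \<Longrightarrow> klin Z (\<lambda>k'. zprod p q k p' q' k')"
  unfolding zprod_def ksw3_def by (intro lin_intros | assumption)+

lemma yprod_lin:
  "q \<in> carr D \<Longrightarrow> p' \<in> carr D \<Longrightarrow> q' \<in> carr D \<Longrightarrow> linear_map D Y (\<lambda>p. yprod p q k p' q' k')"
  "p \<in> carr D \<Longrightarrow> p' \<in> carr D \<Longrightarrow> q' \<in> carr D \<Longrightarrow> linear_map D Y (\<lambda>q. yprod p q k p' q' k')"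
  "p \<in> carr D \<Longrightarrow> q \<in> carr D \<Longrightarrow> p' \<in> carr D \<Longrightarrow> q' \<in> carr D \<Longrightarrow> klin Y (\<lambda>k. yprod p q k p' q' k')"
  "p \<in> carr D \<Longrightarrow> q \<in> carr D \<Longrightarrow> q' \<in> carr D \<Longrightarrow> linear_map D Y (\<lambda>p'. yprod p q k p' q' k')"
  "p \<in> carr D \<Longrightarrow> q \<in> carr D \<Longrightarrow> p' \<in> carr D \<Longrightarrow> linear_map D Y (\<lambda>q'. yprod p q k p' q' k')"
  "p \<in> carr D \<Longrightarrow> q \<in> carr D \<Longrightarrow> p' \<in> carr D \<Longrightarrow> q' \<in> carr D \<Longrightarrow> klin Y (\<lambda>k'. yprod p q k p' q' k')"
  unfolding yprod_def by (intro lin_intros | assumption)+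

lemma multilin_zprod: "p \<in> carr D \<Longrightarrow> q \<in> carr D \<Longrightarrow> multilin Z (zprod p q k)"
  by (intro multilinI zprod_lin)

lemma multilin_yprod: "p \<in> carr D \<Longrightarrow> q \<in> carr D \<Longrightarrow> multilin Y (yprod p q k)"
  by (intro multilinI yprod_lin)

lemma multilin_zlift_zprod: "x' \<in> carr Z \<Longrightarrow> multilin Z (\<lambda>p q k. zlift (zprod p q k) x')"
  by (intro multilinI lin_zlift_param klin_zlift_param vs_Z zprod_lin)

lemma multilin_ylift_yprod: "x' \<in> carr Y \<Longrightarrow> multilin Y (\<lambda>p q k. ylift (yprod p q k) x')"
  by (intro multilinI lin_ylift_param klin_ylift_param vs_Y yprod_lin)

lemma z_mult_zel:
  assumes "p \<in> carr D" "q \<in> carr D" "p' \<in> carr D" "q' \<in> carr D"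
  shows "z_mult H (zel p q k) (zel p' q' k') = zprod p q k p' q' k'"
  unfolding z_mult_lift
  by (simp add: assms zlift_zel[OF vs_Z] multilin_zlift_zprod multilin_zprod zel_mem)

lemma y_mult_yel:
  assumes "p \<in> carr D" "q \<in> carr D" "p' \<in> carr D" "q' \<in> carr D"
  shows "y_mult H (yel p q k) (yel p' q' k') = yprod p q k p' q' k'"
  unfolding y_mult_lift
  by (simp add: assms ylift_yel[OF vs_Y] multilin_ylift_yprod multilin_yprod yel_mem)

lemma lin_z_mult_l: "x' \<in> carr Z \<Longrightarrow> linear_map Z Z (\<lambda>x. z_mult H x x')"
  unfolding z_mult_lift by (rule lin_zlift[OF vs_Z multilin_zlift_zprod])

lemma lin_z_mult_r: "x \<in> carr Z \<Longrightarrow> linear_map Z Z (\<lambda>x'. z_mult H x x')"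
  unfolding z_mult_lift by (intro lin_zlift_param lin_zlift multilin_zprod vs_Z)

lemma lin_y_mult_l: "x' \<in> carr Y \<Longrightarrow> linear_map Y Y (\<lambda>x. y_mult H x x')"
  unfolding y_mult_lift by (rule lin_ylift[OF vs_Y multilin_ylift_yprod])

lemma lin_y_mult_r: "x \<in> carr Y \<Longrightarrow> linear_map Y Y (\<lambda>x'. y_mult H x x')"
  unfolding y_mult_lift by (intro lin_ylift_param lin_ylift multilin_yprod vs_Y)

section \<open>Associativity of the diagonal crossed product\<close>

lemma ksw3_ksw:
  "ksw3 k (\<lambda>a b c. ksw l (\<lambda>u v. F a b c u v)) = ksw l (\<lambda>u v. ksw3 k (\<lambda>a b c. F a b c u v))"
proof -
  have "ksw3 k (\<lambda>a b c. ksw l (\<lambda>u v. F a b c u v)) =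
      ksw k (\<lambda>m c. ksw l (\<lambda>u v. ksw m (\<lambda>a b. F a b c u v)))"
    unfolding ksw3_def by (subst ksw_swap[of _ l]) (rule refl)
  also have "\<dots> = ksw l (\<lambda>u v. ksw3 k (\<lambda>a b c. F a b c u v))"
    unfolding ksw3_def by (rule ksw_swap)
  finally show ?thesis .
qed

lemma ksw3_ksw3:
  "ksw3 k (\<lambda>a b c. ksw3 l (\<lambda>u v w. F a b c u v w)) = ksw3 l (\<lambda>u v w. ksw3 k (\<lambda>a b c. F a b c u v w))"
  unfolding ksw3_def[of l] by (simp only: ksw3_ksw)

lemma ksw3_hom:
  assumes "k_vspace U" "k_vspace W" "linear_map U W f" "\<And>a b c. F a b c \<in> carr U"
  shows "f (ksw3 k F) = ksw3 k (\<lambda>a b c. f (F a b c))"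
  unfolding ksw3_def by (simp add: ksw_hom[OF assms(1-3)] ksw_mem assms)

lemma ksw3_mult:
  assumes U: "k_vspace U"
    and F: "\<And>b c. klin U (\<lambda>a. F a b c)" "\<And>a c. klin U (\<lambda>b. F a b c)" "\<And>a b. klin U (\<lambda>c. F a b c)"
  shows "ksw3 (kmul k l) F =
    ksw3 k (\<lambda>a b c. ksw3 l (\<lambda>a' b' c'. F (kmul a a') (kmul b b') (kmul c c')))"
proof -
  note I = U F klin_ksw_param klin_ksw kend_id
  have "ksw3 (kmul k l) F = ksw k (\<lambda>m c. ksw l (\<lambda>m' c'. ksw (kmul m m') (\<lambda>a b. F a b (kmul c c'))))"
    unfolding ksw3_def by (rule ksw_mult[OF U]) (intro I)+
  also have "\<dots> = ksw k (\<lambda>m c. ksw l (\<lambda>m' c'. ksw m (\<lambda>a b. ksw m' (\<lambda>a' b'.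
      F (kmul a a') (kmul b b') (kmul c c')))))"
    by (subst ksw_mult[OF U, of "\<lambda>a b. F a b _"]) (intro I, intro I, rule refl)
  also have "\<dots> = ksw3 k (\<lambda>a b c. ksw3 l (\<lambda>a' b' c'. F (kmul a a') (kmul b b') (kmul c c')))"
    unfolding ksw3_def by (subst ksw_swap[of l]) (rule refl)
  finally show ?thesis .
qed

text \<open>The same five ordered legs are grouped as 1 + 3 + 1 on the left and 2 + 1 + 2 on the
  right. The fully left-nested splitting lies between the two.\<close>

lemma ksw3_coassoc:
  assumes U: "k_vspace U"
    and F: "\<And>b c d e. klin U (\<lambda>a. F a b c d e)" "\<And>a c d e. klin U (\<lambda>b. F a b c d e)"
      "\<And>a b d e. klin U (\<lambda>c. F a b c d e)" "\<And>a b c e. klin U (\<lambda>d. F a b c d e)"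
      "\<And>a b c d. klin U (\<lambda>e. F a b c d e)"
  shows "ksw3 k (\<lambda>a m e. ksw3 m (\<lambda>b c d. F a b c d e)) =
    ksw3 k (\<lambda>m c n. ksw m (\<lambda>a b. ksw n (\<lambda>d e. F a b c d e)))"
proof -
  note I = U F klin_ksw_param klin_ksw kend_id
  have inner: "ksw m (\<lambda>a n. ksw n (\<lambda>l d. ksw l (\<lambda>b c. F a b c d e))) =
      ksw m (\<lambda>n d. ksw n (\<lambda>l c. ksw l (\<lambda>a b. F a b c d e)))" for m e
  proof -
    have "ksw m (\<lambda>a n. ksw n (\<lambda>l d. ksw l (\<lambda>b c. F a b c d e))) =
        ksw m (\<lambda>n d. ksw n (\<lambda>a l. ksw l (\<lambda>b c. F a b c d e)))"
      by (rule ksw_coassoc[OF U, symmetric]) (intro I)+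
    also have "\<dots> = ksw m (\<lambda>n d. ksw n (\<lambda>l c. ksw l (\<lambda>a b. F a b c d e)))"
      by (subst ksw_coassoc[OF U]) (intro I, intro I, intro I, rule refl)
    finally show ?thesis .
  qed
  have "ksw3 k (\<lambda>a m e. ksw3 m (\<lambda>b c d. F a b c d e)) =
      ksw k (\<lambda>m e. ksw m (\<lambda>n d. ksw n (\<lambda>l c. ksw l (\<lambda>a b. F a b c d e))))"
    by (simp only: ksw3_def inner)
  also have "\<dots> = ksw k (\<lambda>m n. ksw n (\<lambda>d e. ksw m (\<lambda>l c. ksw l (\<lambda>a b. F a b c d e))))"
    by (rule ksw_coassoc[OF U]) (intro I)+
  also have "\<dots> = ksw k (\<lambda>m n. ksw m (\<lambda>l c. ksw l (\<lambda>a b. ksw n (\<lambda>d e. F a b c d e))))"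
  proof -
    have "ksw n (\<lambda>d e. ksw m (\<lambda>l c. ksw l (\<lambda>a b. F a b c d e))) =
        ksw m (\<lambda>l c. ksw l (\<lambda>a b. ksw n (\<lambda>d e. F a b c d e)))" for m n
      by (subst ksw_swap) (subst ksw_swap[of n], rule refl)
    then show ?thesis by (simp only:)
  qed
  finally show ?thesis by (simp only: ksw3_def)
qed

lemma z_mult_assoc_zel:
  assumes m: "p \<in> carr D" "q \<in> carr D" "p' \<in> carr D" "q' \<in> carr D" "p'' \<in> carr D" "q'' \<in> carr D"
  shows "z_mult H (z_mult H (zel p q k) (zel p' q' k')) (zel p'' q'' k'') =
    z_mult H (zel p q k) (z_mult H (zel p' q' k') (zel p'' q'' k''))"
proof -
  note I = m lin_intros
  \<comment> \<open>\<open>G\<close> is the generator common to both bracketings: k1, a, b, c, k3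
    are the five legs of k, and a', b', c' are the three legs of k'.\<close>
  define G where "G k1 a b c k3 a' b' c' =
      zel (mu (mu p (act k1 p')) (act (kmul a a') p''))
        (mu (act (kmul c c') q'') (mu (act k3 q') q)) (kmul (kmul b b') k'')"
    for k1 a b c k3 a' b' c'
  define N where "N k1 a b c k3 = ksw3 k' (G k1 a b c k3)" for k1 a b c k3
  have "z_mult H (z_mult H (zel p q k) (zel p' q' k')) (zel p'' q'' k'') =
      ksw3 k (\<lambda>k1 k2 k3. zprod (mu p (act k1 p')) (mu (act k3 q') q) (kmul k2 k') p'' q'' k'')"
  proof -
    have "z_mult H (z_mult H (zel p q k) (zel p' q' k')) (zel p'' q'' k'') =
        ksw3 k (\<lambda>k1 k2 k3. z_mult H (zel (mu p (act k1 p')) (mu (act k3 q') q) (kmul k2 k')) (zel p'' q'' k''))"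
      unfolding z_mult_zel[OF m(1-4)] zprod_def
      by (rule ksw3_hom[OF vs_Z vs_Z lin_z_mult_l]) (intro I)+
    then show ?thesis by (simp add: z_mult_zel mu_mem act_mem m)
  qed
  also have "\<dots> = ksw3 k (\<lambda>k1 k2 k3. ksw3 k2 (\<lambda>a b c. N k1 a b c k3))"
  proof -
    have "zprod r s (kmul k2 k') p'' q'' k'' =
        ksw3 k2 (\<lambda>a b c. ksw3 k' (\<lambda>a' b' c'. zel (mu r (act (kmul a a') p''))
          (mu (act (kmul c c') q'') s) (kmul (kmul b b') k'')))"
      if "r \<in> carr D" "s \<in> carr D" for r s k2
      unfolding zprod_def by (rule ksw3_mult[OF vs_Z]) (intro I that)+
    then show ?thesis by (simp add: N_def G_def[abs_def] mu_mem act_mem m)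
  qed
  \<comment> \<open>Grouping the legs as 2 + 1 + 2 prepares the module algebra law. The first pair
    acts on p' and p'', the last pair on q'' and q' in this order; the order fits because the second
    slot of \<open>Z\<close> multiplies in reverse.\<close>
  also have "\<dots> = ksw3 k (\<lambda>k1 k2 k3. ksw k1 (\<lambda>x y. ksw k3 (\<lambda>u v. N x y k2 u v)))"
    unfolding N_def G_def ksw3_def[of k'] by (rule ksw3_coassoc[OF vs_Z]) (intro I)+
  also have "\<dots> = ksw3 k' (\<lambda>a' b' c'. ksw3 k (\<lambda>k1 k2 k3. ksw k1 (\<lambda>x y. ksw k3 (\<lambda>u v. G x y k2 u v a' b' c'))))"
    unfolding N_def by (simp only: ksw3_ksw3[of k' k] ksw3_ksw[of k'])
  also have "\<dots> = ksw3 k' (\<lambda>a' b' c'. zprod p q k (mu p' (act a' p'')) (mu (act c' q'') q') (kmul b' k''))"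
  proof -
    have "zel (mu p (act k1 (mu p' (act a' p'')))) (mu (act k3 (mu (act c' q'') q')) q) (kmul k2 (kmul b' k'')) =
        ksw k1 (\<lambda>x y. ksw k3 (\<lambda>u v. G x y k2 u v a' b' c'))" for k1 k2 k3 a' b' c'
    proof -
      have G: "G x y k2 u v a' b' c' =
          zel (mu p (mu (act x p') (act y (act a' p'')))) (mu (mu (act u (act c' q'')) (act v q')) q)
            (kmul k2 (kmul b' k''))" for x y u v
        by (simp add: G_def mu_assoc act_mul kmul_assoc mu_mem act_mem m)
      have "zel (mu p (act k1 (mu p' (act a' p'')))) s l =
          ksw k1 (\<lambda>x y. zel (mu p (mu (act x p') (act y (act a' p'')))) s l)" if "s \<in> carr D" for s l
      proof -
        have *: "linear_map D Z (\<lambda>r. zel (mu p r) s l)" by (intro I that)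
        show ?thesis
          unfolding act_mu[OF m(3) act_mem[OF m(5)]] by (rule ksw_hom[OF vs_D vs_Z *]) (intro I)
      qed
      moreover have "zel r (mu (act k3 (mu (act c' q'') q')) q) l =
          ksw k3 (\<lambda>u v. zel r (mu (mu (act u (act c' q'')) (act v q')) q) l)" if "r \<in> carr D" for r l
      proof -
        have *: "linear_map D Z (\<lambda>s. zel r (mu s q) l)" by (intro I that)
        show ?thesis
          unfolding act_mu[OF act_mem[OF m(6)] m(4)] by (rule ksw_hom[OF vs_D vs_Z *]) (intro I)
      qed
      ultimately show ?thesis by (simp add: G mu_mem act_mem m ksw_swap[of k3 k1])
    qed
    then show ?thesis by (simp only: zprod_def)
  qed
  also have "\<dots> = z_mult H (zel p q k) (z_mult H (zel p' q' k') (zel p'' q'' k''))"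
  proof -
    have "z_mult H (zel p q k) (z_mult H (zel p' q' k') (zel p'' q'' k'')) =
        ksw3 k' (\<lambda>a' b' c'. z_mult H (zel p q k) (zel (mu p' (act a' p'')) (mu (act c' q'') q') (kmul b' k'')))"
      unfolding z_mult_zel[OF m(3-6)] zprod_def[of p' q']
      by (rule ksw3_hom[OF vs_Z vs_Z lin_z_mult_r]) (intro I)+
    then show ?thesis by (simp add: z_mult_zel mu_mem act_mem m)
  qed
  finally show ?thesis .
qed

lemma z_mult_mem: "x \<in> carr Z \<Longrightarrow> y \<in> carr Z \<Longrightarrow> z_mult H x y \<in> carr Z"
  using linear_mapD(1)[OF lin_z_mult_l] .

lemma y_mult_mem: "x \<in> carr Y \<Longrightarrow> y \<in> carr Y \<Longrightarrow> y_mult H x y \<in> carr Y"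
  using linear_mapD(1)[OF lin_y_mult_l] .

lemma z_mult_assoc:
  assumes x: "x \<in> carr Z" and y: "y \<in> carr Z" and z: "z \<in> carr Z"
  shows "z_mult H (z_mult H x y) z = z_mult H x (z_mult H y z)"
proof (rule z_eqI[where f = "\<lambda>x. z_mult H (z_mult H x y) z" and g = "\<lambda>x. z_mult H x (z_mult H y z)",
      OF vs_Z _ _ _ x])
  show "linear_map Z Z (\<lambda>x. z_mult H (z_mult H x y) z)"
    by (rule linear_map_comp[OF lin_z_mult_l[OF z] lin_z_mult_l[OF y]])
  show "linear_map Z Z (\<lambda>x. z_mult H x (z_mult H y z))"
    by (rule lin_z_mult_l[OF z_mult_mem[OF y z]])
  fix p q k assume "p \<in> carr D" "q \<in> carr D"
  then have x': "zel p q k \<in> carr Z" and pq: "p \<in> carr D" "q \<in> carr D" by (simp_all add: zel_mem)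
  show "z_mult H (z_mult H (zel p q k) y) z = z_mult H (zel p q k) (z_mult H y z)"
  proof (rule z_eqI[where f = "\<lambda>y. z_mult H (z_mult H (zel p q k) y) z"
        and g = "\<lambda>y. z_mult H (zel p q k) (z_mult H y z)", OF vs_Z _ _ _ y])
    show "linear_map Z Z (\<lambda>y. z_mult H (z_mult H (zel p q k) y) z)"
      by (rule linear_map_comp[OF lin_z_mult_l[OF z] lin_z_mult_r[OF x']])
    show "linear_map Z Z (\<lambda>y. z_mult H (zel p q k) (z_mult H y z))"
      by (rule linear_map_comp[OF lin_z_mult_r[OF x'] lin_z_mult_l[OF z]])
    fix p' q' k' assume pq': "p' \<in> carr D" "q' \<in> carr D"
    then have y': "zel p' q' k' \<in> carr Z" by (rule zel_mem)
    show "z_mult H (z_mult H (zel p q k) (zel p' q' k')) z = z_mult H (zel p q k) (z_mult H (zel p' q' k') z)"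
      by (rule z_eqI[OF vs_Z lin_z_mult_r[OF z_mult_mem[OF x' y']]
            linear_map_comp[OF lin_z_mult_r[OF x'] lin_z_mult_r[OF y']] _ z])
         (rule z_mult_assoc_zel[OF pq pq'])
  qed
qed

text \<open>For the left unit every leg is \<open>kone\<close>. For the right unit the outer legs
  act on \<epsilon> by scalars, which the counit laws absorb.\<close>

lemma z_mult_one:
  assumes x: "x \<in> carr Z"
  shows "z_mult H (zel \<epsilon> \<epsilon> kone) x = x" "z_mult H x (zel \<epsilon> \<epsilon> kone) = x"
proof -
  note one = zel_mem[OF counit_mem counit_mem, of kone]
  show "z_mult H (zel \<epsilon> \<epsilon> kone) x = x"
  proof (rule z_eqI[OF vs_Z lin_z_mult_r[OF one] linear_map_id _ x])
    fix p q k assume m: "p \<in> carr D" "q \<in> carr D"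
    note I = m counit_mem lin_intros
    have "z_mult H (zel \<epsilon> \<epsilon> kone) (zel p q k) = zprod \<epsilon> \<epsilon> kone p q k"
      by (simp add: z_mult_zel m counit_mem)
    also have "\<dots> = ksw kone (\<lambda>k1 k2. zel (mu \<epsilon> (act k1 p)) (mu (act kone q) \<epsilon>) (kmul k2 k))"
      unfolding zprod_def ksw3_def by (rule ksw_one[OF vs_Z]) (intro I)+
    also have "\<dots> = zel (mu \<epsilon> (act kone p)) (mu (act kone q) \<epsilon>) (kmul kone k)"
      by (rule ksw_one[OF vs_Z]) (intro I)+
    also have "\<dots> = zel p q k" by (simp add: mu_counit_l mu_counit_r m)
    finally show "z_mult H (zel \<epsilon> \<epsilon> kone) (zel p q k) = zel p q k" .
  qed
  show "z_mult H x (zel \<epsilon> \<epsilon> kone) = x"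
  proof (rule z_eqI[OF vs_Z lin_z_mult_l[OF one] linear_map_id _ x])
    fix p q k assume m: "p \<in> carr D" "q \<in> carr D"
    note I = m counit_mem lin_intros
    have s: "mu p (fscale c \<epsilon>) = fscale c p" "mu (fscale c \<epsilon>) q = fscale c q" for c
      using linear_mapD(3)[OF lin_mu_r[OF m(1)] counit_mem, of c]
        linear_mapD(3)[OF lin_mu_l[OF m(2)] counit_mem, of c]
      by (simp_all add: mu_counit_l mu_counit_r m)
    have t: "zel (fscale c p) (fscale d q) l = scal Z c (scal Z d (zel p q l))" for c d l
      using linear_mapD(3)[OF multilinD(1)[OF multilin_zel], of "fscale d q" p c l]
        linear_mapD(3)[OF multilinD(2)[OF multilin_zel], of p q d l] k_vspaceD(4)[OF vs_D, of q d] m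
      by simp
    have "z_mult H (zel p q k) (zel \<epsilon> \<epsilon> kone) = zprod p q k \<epsilon> \<epsilon> kone"
      by (simp add: z_mult_zel m counit_mem)
    also have "\<dots> = ksw k (\<lambda>l k3. ksw l (\<lambda>k1 k2. scal Z (keps k1) (scal Z (keps k3) (zel p q k2))))"
      by (simp add: zprod_def ksw3_def act_counit s t)
    also have "\<dots> = ksw k (\<lambda>l k3. scal Z (keps k3) (zel p q l))"
      by (subst ksw_counit_l[OF vs_Z])
         (intro I klin_comp[OF lin_scal[OF vs_Z]], rule refl)
    also have "\<dots> = zel p q k"
      by (rule ksw_counit_r[OF vs_Z]) (intro I)
    finally show "z_mult H (zel p q k) (zel \<epsilon> \<epsilon> kone) = zel p q k" .
  qed
qed

section \<open>The isomorphism\<close>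

definition alpha :: "('k, 'h) ytensor \<Rightarrow> ('k, 'h) ztensor" where
  "alpha = ylift (\<lambda>p q k. ksw k (\<lambda>k1 k2. zel p (act k2 q) k1))"

definition beta :: "('k, 'h) ztensor \<Rightarrow> ('k, 'h) ytensor" where
  "beta = zlift (\<lambda>p q k. ksw k (\<lambda>k1 k2. yel p (act (kS k2) q) k1))"

lemma multilin_alpha: "multilin Z (\<lambda>p q k. ksw k (\<lambda>k1 k2. zel p (act k2 q) k1))"
  by (rule multilinI) (intro lin_intros | assumption)+

lemma multilin_beta: "multilin Y (\<lambda>p q k. ksw k (\<lambda>k1 k2. yel p (act (kS k2) q) k1))"
  by (rule multilinI) (intro lin_intros | assumption)+

lemmas lin_alpha = lin_ylift[OF vs_Z multilin_alpha, folded alpha_def]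
lemmas lin_beta = lin_zlift[OF vs_Y multilin_beta, folded beta_def]
lemmas alpha_yel = ylift_yel[OF vs_Z multilin_alpha, folded alpha_def]
lemmas beta_zel = zlift_zel[OF vs_Y multilin_beta, folded beta_def]

text \<open>The antipode introduced by \<open>beta\<close> and the leg introduced by
  \<open>alpha\<close> act on q as S(b) k_2, and coassociativity makes b and k_2 adjacent legs, so
  they contract. In \<open>alpha_beta\<close> the order is b S(k_2).\<close>

lemma beta_alpha:
  assumes y: "y \<in> carr Y"
  shows "beta (alpha y) = y"
proof (rule y_eqI[OF vs_Y linear_map_comp[OF lin_beta lin_alpha] linear_map_id _ y])
  fix p q k assume m: "p \<in> carr D" "q \<in> carr D"
  note I = m lin_intros
  have "beta (alpha (yel p q k)) = ksw k (\<lambda>k1 k2. beta (zel p (act k2 q) k1))"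
    unfolding alpha_yel[OF m] by (rule ksw_hom[OF vs_Z vs_Y lin_beta]) (intro I)
  also have "\<dots> = ksw k (\<lambda>l k2. ksw l (\<lambda>a b. yel p (act (kS b) (act k2 q)) a))"
    by (simp add: beta_zel m act_mem)
  also have "\<dots> = ksw k (\<lambda>a l. ksw l (\<lambda>b k2. yel p (act (kS b) (act k2 q)) a))"
    by (rule ksw_coassoc[OF vs_Y]) (intro I)+
  also have "\<dots> = ksw k (\<lambda>a l. ksw l (\<lambda>b k2. yel p (act (kmul (kS b) k2) q) a))"
    by (simp only: act_mul)
  also have "\<dots> = yel p (act kone q) k"
    by (rule ksw_cancel(1)[OF vs_Y]) (intro I)+
  finally show "beta (alpha (yel p q k)) = yel p q k" by simp
qed

lemma alpha_beta:
  assumes z: "z \<in> carr Z"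
  shows "alpha (beta z) = z"
proof (rule z_eqI[OF vs_Z linear_map_comp[OF lin_alpha lin_beta] linear_map_id _ z])
  fix p q k assume m: "p \<in> carr D" "q \<in> carr D"
  note I = m lin_intros
  have "alpha (beta (zel p q k)) = ksw k (\<lambda>k1 k2. alpha (yel p (act (kS k2) q) k1))"
    unfolding beta_zel[OF m] by (rule ksw_hom[OF vs_Y vs_Z lin_alpha]) (intro I)
  also have "\<dots> = ksw k (\<lambda>l k2. ksw l (\<lambda>a b. zel p (act b (act (kS k2) q)) a))"
    by (simp add: alpha_yel m act_mem)
  also have "\<dots> = ksw k (\<lambda>a l. ksw l (\<lambda>b k2. zel p (act b (act (kS k2) q)) a))"
    by (rule ksw_coassoc[OF vs_Z]) (intro I)+
  also have "\<dots> = ksw k (\<lambda>a l. ksw l (\<lambda>b k2. zel p (act (kmul b (kS k2)) q) a))"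
    by (simp only: act_mul)
  also have "\<dots> = zel p (act kone q) k"
    by (rule ksw_cancel(2)[OF vs_Z]) (intro I)+
  finally show "alpha (beta (zel p q k)) = zel p q k" by simp
qed

text \<open>The product of \<open>Y\<close> lets S(l_2) act on q, and \<open>alpha\<close> places a
  leg of l_1 to its left; these two contract. What remains involves four legs of k and two of k',
  exactly as the product in \<open>Z\<close> does.\<close>

lemma alpha_mult_yel:
  assumes m: "p \<in> carr D" "q \<in> carr D" "p' \<in> carr D" "q' \<in> carr D"
  shows "alpha (y_mult H (yel p q k) (yel p' q' k')) = z_mult H (alpha (yel p q k)) (alpha (yel p' q' k'))"
proof -
  note I = m lin_intros
  \<comment> \<open>The argument z holds d_2 S(l_2) and becomes \<open>kone\<close> once that pair
    is contracted. \<open>N\<close> is the sum over k' after this contraction.\<close>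
  define M where "M k1 a b1 b2 c d z =
      zel (mu p (act k1 p')) (mu (act (kmul b1 d) q') (act (kmul b2 z) q)) (kmul a c)"
    for k1 a b1 b2 c d z
  define N where "N k1 a b1 b2 = ksw k' (\<lambda>c d. M k1 a b1 b2 c d kone)" for k1 a b1 b2
  have "alpha (y_mult H (yel p q k) (yel p' q' k')) =
      ksw k (\<lambda>k1 k2. ksw k' (\<lambda>l1 l2. alpha (yel (mu p (act k1 p')) (mu q' (act (kS l2) q)) (kmul k2 l1))))"
  proof -
    have "alpha (y_mult H (yel p q k) (yel p' q' k')) =
        ksw k (\<lambda>k1 k2. alpha (ksw k' (\<lambda>l1 l2. yel (mu p (act k1 p')) (mu q' (act (kS l2) q)) (kmul k2 l1))))"
      unfolding y_mult_yel[OF m] yprod_def by (rule ksw_hom[OF vs_Y vs_Z lin_alpha]) (intro I)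
    also have "\<dots> = ksw k (\<lambda>k1 k2. ksw k' (\<lambda>l1 l2. alpha (yel (mu p (act k1 p')) (mu q' (act (kS l2) q)) (kmul k2 l1))))"
      by (subst ksw_hom[OF vs_Y vs_Z lin_alpha]) (intro I, rule refl)
    finally show ?thesis .
  qed
  also have "\<dots> = ksw k (\<lambda>k1 k2. ksw k' (\<lambda>l1 l2. ksw k2 (\<lambda>a b. ksw l1 (\<lambda>c d.
      ksw b (\<lambda>b1 b2. ksw d (\<lambda>d1 d2. M k1 a b1 b2 c d1 (kmul d2 (kS l2))))))))"
  proof -
    have "alpha (yel r (mu q' (act l q)) (kmul k2 l1)) =
        ksw k2 (\<lambda>a b. ksw l1 (\<lambda>c d. ksw b (\<lambda>b1 b2. ksw d (\<lambda>d1 d2.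
          zel r (mu (act (kmul b1 d1) q') (act (kmul b2 (kmul d2 l)) q)) (kmul a c)))))"
      if r: "r \<in> carr D" for r l k2 l1
    proof -
      have "alpha (yel r (mu q' (act l q)) (kmul k2 l1)) =
          ksw (kmul k2 l1) (\<lambda>a b. zel r (act b (mu q' (act l q))) a)"
        by (simp add: alpha_yel r mu_mem act_mem m)
      also have "\<dots> = ksw k2 (\<lambda>a b. ksw l1 (\<lambda>c d. zel r (act (kmul b d) (mu q' (act l q))) (kmul a c)))"
        by (rule ksw_mult[OF vs_Z]) (intro I r)+
      also have "\<dots> = ksw k2 (\<lambda>a b. ksw l1 (\<lambda>c d. ksw b (\<lambda>b1 b2. ksw d (\<lambda>d1 d2.
          zel r (mu (act (kmul b1 d1) q') (act (kmul b2 d2) (act l q))) (kmul a c)))))"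
      proof -
        have "zel r (act (kmul b d) (mu q' (act l q))) s =
          ksw b (\<lambda>b1 b2. ksw d (\<lambda>d1 d2. zel r (mu (act (kmul b1 d1) q') (act (kmul b2 d2) (act l q))) s))" for b d s
        proof -
          have *: "linear_map D Z (\<lambda>v. zel r v s)" by (intro I r)
          have "zel r (act (kmul b d) (mu q' (act l q))) s =
              ksw (kmul b d) (\<lambda>u v. zel r (mu (act u q') (act v (act l q))) s)"
            unfolding act_mu[OF m(4) act_mem[OF m(2)]] by (rule ksw_hom[OF vs_D vs_Z *]) (intro I)
          also have "\<dots> = ksw b (\<lambda>b1 b2. ksw d (\<lambda>d1 d2. zel r (mu (act (kmul b1 d1) q') (act (kmul b2 d2) (act l q))) s))"
            by (rule ksw_mult[OF vs_Z]) (intro I r)+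
          finally show ?thesis .
        qed
        then show ?thesis by (simp only:)
      qed
      finally show ?thesis by (simp only: act_mul[symmetric] kmul_assoc)
    qed
    then show ?thesis by (simp add: M_def mu_mem act_mem m)
  qed
  also have "\<dots> = ksw k (\<lambda>k1 k2. ksw k2 (\<lambda>a b. ksw b (\<lambda>b1 b2. N k1 a b1 b2)))"
  proof -
    have "ksw k' (\<lambda>l1 l2. ksw k2 (\<lambda>a b. ksw l1 (\<lambda>c d. ksw b (\<lambda>b1 b2. ksw d (\<lambda>d1 d2.
          M k1 a b1 b2 c d1 (kmul d2 (kS l2))))))) =
        ksw k2 (\<lambda>a b. ksw b (\<lambda>b1 b2. N k1 a b1 b2))" for k1 k2
    proof -
      have "ksw k' (\<lambda>l1 l2. ksw k2 (\<lambda>a b. ksw l1 (\<lambda>c d. ksw b (\<lambda>b1 b2. ksw d (\<lambda>d1 d2.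
          M k1 a b1 b2 c d1 (kmul d2 (kS l2))))))) =
        ksw k2 (\<lambda>a b. ksw k' (\<lambda>l1 l2. ksw l1 (\<lambda>c d. ksw b (\<lambda>b1 b2. ksw d (\<lambda>d1 d2.
          M k1 a b1 b2 c d1 (kmul d2 (kS l2)))))))"
        by (rule ksw_swap)
      also have "\<dots> = ksw k2 (\<lambda>a b. ksw k' (\<lambda>l1 l2. ksw b (\<lambda>b1 b2. ksw l1 (\<lambda>c d. ksw d (\<lambda>d1 d2.
          M k1 a b1 b2 c d1 (kmul d2 (kS l2)))))))"
        by (subst (3) ksw_swap) (rule refl)
      also have "\<dots> = ksw k2 (\<lambda>a b. ksw b (\<lambda>b1 b2. ksw k' (\<lambda>l1 l2. ksw l1 (\<lambda>c d. ksw d (\<lambda>d1 d2.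
          M k1 a b1 b2 c d1 (kmul d2 (kS l2)))))))"
        by (subst ksw_swap[of k']) (rule refl)
      also have "\<dots> = ksw k2 (\<lambda>a b. ksw b (\<lambda>b1 b2. N k1 a b1 b2))"
      proof -
        have "ksw k' (\<lambda>l1 l2. ksw l1 (\<lambda>c d. ksw d (\<lambda>d1 d2. M k1 a b1 b2 c d1 (kmul d2 (kS l2))))) =
            N k1 a b1 b2" for a b1 b2
        proof -
          have "ksw k' (\<lambda>l1 l2. ksw l1 (\<lambda>c d. ksw d (\<lambda>d1 d2. M k1 a b1 b2 c d1 (kmul d2 (kS l2))))) =
              ksw k' (\<lambda>c e. ksw e (\<lambda>d l2. ksw d (\<lambda>d1 d2. M k1 a b1 b2 c d1 (kmul d2 (kS l2)))))"
            unfolding M_def by (rule ksw_coassoc[OF vs_Z]) (intro I)+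
          also have "\<dots> = ksw k' (\<lambda>c e. ksw e (\<lambda>d1 f. ksw f (\<lambda>d2 l2. M k1 a b1 b2 c d1 (kmul d2 (kS l2)))))"
            unfolding M_def by (subst ksw_coassoc[OF vs_Z]) (intro I, intro I, intro I, rule refl)
          also have "\<dots> = ksw k' (\<lambda>c e. M k1 a b1 b2 c e kone)"
            unfolding M_def by (subst ksw_cancel(2)[OF vs_Z]) (intro I, intro I, rule refl)
          finally show ?thesis by (simp only: N_def)
        qed
        then show ?thesis by (simp only:)
      qed
      finally show ?thesis .
    qed
    then show ?thesis by (simp only:)
  qed
  \<comment> \<open>The first three legs of k are those consumed by the product of \<open>Z\<close>;
    the fourth is the one with which \<open>alpha\<close> acts on q.\<close>
  also have "\<dots> = ksw k (\<lambda>l b2. ksw3 l (\<lambda>k1 a b1. N k1 a b1 b2))"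
  proof -
    have "ksw k (\<lambda>k1 k2. ksw k2 (\<lambda>a b. ksw b (\<lambda>b1 b2. N k1 a b1 b2))) =
        ksw k (\<lambda>l b. ksw l (\<lambda>k1 a. ksw b (\<lambda>b1 b2. N k1 a b1 b2)))"
      unfolding N_def M_def by (rule ksw_coassoc[OF vs_Z, symmetric]) (intro I)+
    also have "\<dots> = ksw k (\<lambda>l b. ksw b (\<lambda>b1 b2. ksw l (\<lambda>k1 a. N k1 a b1 b2)))"
      by (subst (2) ksw_swap) (rule refl)
    also have "\<dots> = ksw k (\<lambda>n b2. ksw n (\<lambda>l b1. ksw l (\<lambda>k1 a. N k1 a b1 b2)))"
      unfolding N_def M_def by (rule ksw_coassoc[OF vs_Z, symmetric]) (intro I)+
    finally show ?thesis by (simp only: ksw3_def)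
  qed
  also have "\<dots> = ksw k (\<lambda>k1 k2. ksw k' (\<lambda>l1 l2. zprod p (act k2 q) k1 p' (act l2 q') l1))"
  proof -
    have "ksw3 l (\<lambda>k1 a b1. N k1 a b1 b2) = ksw k' (\<lambda>l1 l2. zprod p (act b2 q) l p' (act l2 q') l1)" for l b2
      unfolding N_def ksw3_ksw by (simp add: zprod_def M_def act_mul)
    then show ?thesis by (simp only:)
  qed
  also have "\<dots> = z_mult H (alpha (yel p q k)) (alpha (yel p' q' k'))"
  proof -
    have "z_mult H (alpha (yel p q k)) (alpha (yel p' q' k')) =
        ksw k (\<lambda>k1 k2. z_mult H (zel p (act k2 q) k1) (alpha (yel p' q' k')))"
      unfolding alpha_yel[OF m(1,2)]
      by (rule ksw_hom[OF vs_Z vs_Z lin_z_mult_l]) (intro I linear_mapD(1)[OF lin_alpha])+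
    also have "\<dots> = ksw k (\<lambda>k1 k2. ksw k' (\<lambda>l1 l2. z_mult H (zel p (act k2 q) k1) (zel p' (act l2 q') l1)))"
      unfolding alpha_yel[OF m(3,4)]
      by (subst ksw_hom[OF vs_Z vs_Z lin_z_mult_r]) (intro I, intro I, rule refl)
    finally show ?thesis by (simp add: z_mult_zel m act_mem)
  qed
  finally show ?thesis .
qed

lemma alpha_mult:
  assumes x: "x \<in> carr Y" and y: "y \<in> carr Y"
  shows "alpha (y_mult H x y) = z_mult H (alpha x) (alpha y)"
proof (rule y_eqI[where f = "\<lambda>x. alpha (y_mult H x y)" and g = "\<lambda>x. z_mult H (alpha x) (alpha y)",
      OF vs_Z _ _ _ x])
  note a = linear_mapD(1)[OF lin_alpha]
  show "linear_map Y Z (\<lambda>x. alpha (y_mult H x y))"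
    by (rule linear_map_comp[OF lin_alpha lin_y_mult_l[OF y]])
  show "linear_map Y Z (\<lambda>x. z_mult H (alpha x) (alpha y))"
    by (rule linear_map_comp[OF lin_z_mult_l[OF a[OF y]] lin_alpha])
  fix p q k assume m: "p \<in> carr D" "q \<in> carr D"
  then have x': "yel p q k \<in> carr Y" by (rule yel_mem)
  show "alpha (y_mult H (yel p q k) y) = z_mult H (alpha (yel p q k)) (alpha y)"
    by (rule y_eqI[OF vs_Z linear_map_comp[OF lin_alpha lin_y_mult_r[OF x']]
          linear_map_comp[OF lin_z_mult_r[OF a[OF x']] lin_alpha] _ y])
       (rule alpha_mult_yel[OF m])
qed

lemma alpha_one: "alpha (yel \<epsilon> \<epsilon> kone) = zel \<epsilon> \<epsilon> kone"
proof -
  note I = counit_mem lin_intros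
  have "alpha (yel \<epsilon> \<epsilon> kone) = ksw kone (\<lambda>k1 k2. zel \<epsilon> (act k2 \<epsilon>) k1)"
    by (rule alpha_yel[OF counit_mem counit_mem])
  also have "\<dots> = zel \<epsilon> (act kone \<epsilon>) kone"
    by (rule ksw_one[OF vs_Z]) (intro I)+
  finally show ?thesis by simp
qed

section \<open>The two algebras and the mutually inverse homomorphisms\<close>

abbreviation "YA \<equiv> two_sided_crossed_product H"
abbreviation "ZA \<equiv> diagonal_crossed_product H"

lemma YA_simps [simp]:
  "carr YA = carr Y" "scal YA = scal Y" "amult YA = y_mult H" "aone YA = yel \<epsilon> \<epsilon> kone"
  by (simp_all add: two_sided_crossed_product_def yel_def)

lemma ZA_simps [simp]:
  "carr ZA = carr Z" "scal ZA = scal Z" "amult ZA = z_mult H" "aone ZA = zel \<epsilon> \<epsilon> kone"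
  by (simp_all add: diagonal_crossed_product_def zel_def)

lemma k_algebra_Z: "k_algebra ZA"
  using vs_Z lin_z_mult_l lin_z_mult_r z_mult_assoc z_mult_one zel_mem[OF counit_mem counit_mem, of kone]
  by (simp add: k_algebra_def k_vspace_def bilinear_map_def linear_map_def)

text \<open>This moves identities in \<open>Y\<close> to \<open>Z\<close>, where the algebra laws
  are already available; multiplicativity of \<open>beta\<close> is obtained from that of
  \<open>alpha\<close> in the same way.\<close>

lemma alpha_inj: "x \<in> carr Y \<Longrightarrow> y \<in> carr Y \<Longrightarrow> alpha x = alpha y \<Longrightarrow> x = y"
  by (metis beta_alpha)

lemma k_algebra_Y: "k_algebra YA"
proof -
  note a = linear_mapD(1)[OF lin_alpha]
  note one = yel_mem[OF counit_mem counit_mem, of kone]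
  have "y_mult H (y_mult H x y) z = y_mult H x (y_mult H y z)"
    if "x \<in> carr Y" "y \<in> carr Y" "z \<in> carr Y" for x y z
    by (rule alpha_inj) (simp_all add: alpha_mult y_mult_mem z_mult_assoc a that)
  moreover have "y_mult H (yel \<epsilon> \<epsilon> kone) x = x" "y_mult H x (yel \<epsilon> \<epsilon> kone) = x" if "x \<in> carr Y" for x
    by (rule alpha_inj; simp add: alpha_mult y_mult_mem z_mult_one alpha_one one a that)+
  ultimately show ?thesis
    using vs_Y lin_y_mult_l lin_y_mult_r one
    by (simp add: k_algebra_def k_vspace_def bilinear_map_def linear_map_def)
qed

lemma alpha_hom: "k_algebra_hom YA ZA alpha"
  using lin_alpha alpha_mult alpha_one by (simp add: k_algebra_hom_def linear_map_def)

lemma beta_hom: "k_algebra_hom ZA YA beta"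
proof -
  note b = linear_mapD(1)[OF lin_beta]
  have "beta (z_mult H x y) = y_mult H (beta x) (beta y)" if "x \<in> carr Z" "y \<in> carr Z" for x y
    by (rule alpha_inj) (simp_all add: alpha_mult alpha_beta y_mult_mem z_mult_mem b that)
  moreover have "beta (zel \<epsilon> \<epsilon> kone) = yel \<epsilon> \<epsilon> kone"
    using beta_alpha[OF yel_mem[OF counit_mem counit_mem, of kone]] by (simp add: alpha_one)
  ultimately show ?thesis
    using lin_beta by (simp add: k_algebra_hom_def linear_map_def)
qed

lemma alpha_y_elem:
  assumes "p \<in> carr D" "q \<in> carr D"
  shows "alpha (y_elem H p h g q) =
    sw h (\<lambda>h1 h2. sw g (\<lambda>g1 g2. z_elem H p (h2 \<rightharpoonup> q \<leftharpoonup> g2) h1 g1))"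
  using alpha_yel[OF assms, of "(h, g)"] by (simp add: yel_def zel_def ksw_def act_def)

lemma beta_z_elem:
  assumes "p \<in> carr D" "q \<in> carr D"
  shows "beta (z_elem H p q h g) =
    sw h (\<lambda>h1 h2. sw g (\<lambda>g1 g2. y_elem H p h1 g1 (S h2 \<rightharpoonup> q \<leftharpoonup> S' g2)))"
  using beta_zel[OF assms, of "(h, g)"] by (simp add: yel_def zel_def ksw_def act_def kS_def)

end

theorem mainTheorem5:
  fixes H :: "('k::field, 'h::ring_1) hopf" and Basis :: "'h set"
  assumes "hopf_algebra H"
    and "finite_dimensional_vector_space (hscale H) Basis"
  shows "k_algebra (two_sided_crossed_product H) \<and>
    k_algebra (diagonal_crossed_product H) \<and>
    (\<exists>\<alpha> \<alpha>'.
      k_algebra_hom (two_sided_crossed_product H) (diagonal_crossed_product H) \<alpha> \<and>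
      k_algebra_hom (diagonal_crossed_product H) (two_sided_crossed_product H) \<alpha>' \<and>
      (\<forall>y\<in>carr (two_sided_crossed_product H). \<alpha>' (\<alpha> y) = y) \<and>
      (\<forall>z\<in>carr (diagonal_crossed_product H). \<alpha> (\<alpha>' z) = z) \<and>
      (\<forall>p\<in>carr (dual_alg H). \<forall>q\<in>carr (dual_alg H). \<forall>h g.
         \<alpha> (y_elem H p h g q) =
           sweedler2 H h (\<lambda>h1 h2. sweedler2 H g (\<lambda>g1 g2.
             z_elem H p (h2 \<rightharpoonup> q \<leftharpoonup> g2) h1 g1))) \<and>
      (\<forall>p\<in>carr (dual_alg H). \<forall>q\<in>carr (dual_alg H). \<forall>h g.
         \<alpha>' (z_elem H p q h g) =
           sweedler2 H h (\<lambda>h1 h2. sweedler2 H g (\<lambda>g1 g2.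
             y_elem H p h1 g1 (antipode H h2 \<rightharpoonup> q \<leftharpoonup> antipode_inv H g2)))))"
proof -
  interpret fd_hopf_structure H Basis
    using assms by (simp add: fd_hopf_structure_def fd_hopf_structure_axioms_def hopf_structure_def)
  show ?thesis
    by (intro conjI exI[of _ alpha] exI[of _ beta] k_algebra_Y k_algebra_Z alpha_hom beta_hom)
       (simp_all add: beta_alpha alpha_beta alpha_y_elem beta_z_elem)
qed

end
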